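(* Let $a=(a_1,\dots,a_n)$ be an $n$-tuple of positive integers and $X\subseteq B(a)$. There exists an RT-diagram on the zonogon $Z(a)$ whose vertex set contains $\pi(X)$ if and only if there do not exist $1\le i<j<k\le n$ and $x,x'\in X$ with $x_i<x'_i$, $x_j>x'_j$ and $x_k<x'_k$.
   Context: $B(a)=\{x\in\mathbb Z^n:0\le x\le a\}$. Choose vectors $\xi_1,\dots,\xi_n$ in the upper half-plane $\mathbb R\times\mathbb R_{+}$ of equal Euclidean norm, ordered clockwise around the origin, with all integer combinations distinct; $\pi(x)=\sum_i x_i\xi_i$. The zonogon is $Z(a)=\{\sum\lambda_i\xi_i:0\le\lambda_i\le a_i\}$. An RT-diagram on $Z(a)$ is a subdivision of $Z(a)$ into rhombi of the form $v+\{\lambda_i\xi_i+\lambda_j\xi_j:0\le\lambda_i,\lambda_j\le 1\}$ ($i<j$); its vertices are the vertices of these rhombi. *)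

theory Defs
  imports "HOL-Analysis.Analysis"
begin

text \<open>
  Indices range over \<open>{1..n}\<close>.  Integer vectors of length \<open>n\<close> are the extensional functions
  \<open>{1..n} \<rightarrow>\<^sub>E UNIV\<close>, so that equality of functions is equality of tuples.
\<close>

definition int_box :: "nat \<Rightarrow> (nat \<Rightarrow> int) \<Rightarrow> (nat \<Rightarrow> int) set" where
  "int_box n a = (\<Pi>\<^sub>E i\<in>{1..n}. {0..a i})"

definition plane_proj :: "nat \<Rightarrow> (nat \<Rightarrow> real \<times> real) \<Rightarrow> (nat \<Rightarrow> int) \<Rightarrow> real \<times> real" where
  "plane_proj n \<xi> x = (\<Sum>i=1..n. real_of_int (x i) *\<^sub>R \<xi> i)"

text \<open>
  The norm on \<open>real \<times> real\<close> is the Euclidean one.  In the third conjunct, a negative determinant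
  says that \<open>\<xi> j\<close> is reached from \<open>\<xi> i\<close> by a clockwise rotation through an angle strictly between
  0 and pi.  The half-plane is taken closed, which also covers vectors in the open half-plane.
\<close>

definition generating_vectors :: "nat \<Rightarrow> (nat \<Rightarrow> real \<times> real) \<Rightarrow> bool" where
  "generating_vectors n \<xi> \<longleftrightarrow>
     (\<forall>i\<in>{1..n}. \<xi> i \<in> UNIV \<times> {0..}) \<and>
     (\<forall>i\<in>{1..n}. \<forall>j\<in>{1..n}. norm (\<xi> i) = norm (\<xi> j)) \<and>
     (\<forall>i\<in>{1..n}. \<forall>j\<in>{1..n}. i < j \<longrightarrow>
        fst (\<xi> i) * snd (\<xi> j) - snd (\<xi> i) * fst (\<xi> j) < 0) \<and>
     inj_on (plane_proj n \<xi>) ({1..n} \<rightarrow>\<^sub>E UNIV)"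

definition zonogon :: "nat \<Rightarrow> (nat \<Rightarrow> real \<times> real) \<Rightarrow> (nat \<Rightarrow> int) \<Rightarrow> (real \<times> real) set" where
  "zonogon n \<xi> a =
     {(\<Sum>i=1..n. l i *\<^sub>R \<xi> i) | l. \<forall>i\<in>{1..n}. 0 \<le> l i \<and> l i \<le> real_of_int (a i)}"

definition rhombus ::
    "(nat \<Rightarrow> real \<times> real) \<Rightarrow> real \<times> real \<Rightarrow> nat \<Rightarrow> nat \<Rightarrow> (real \<times> real) set" where
  "rhombus \<xi> v i j = {v + (s *\<^sub>R \<xi> i + t *\<^sub>R \<xi> j) | s t. 0 \<le> s \<and> s \<le> 1 \<and> 0 \<le> t \<and> t \<le> 1}"

text \<open>
  A subdivision is understood as a polyhedral one: finitely many tiles that cover the zonogon,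
  any two of which meet in a (possibly empty) common face.  In particular, distinct tiles have
  disjoint interiors.
\<close>

definition RT_diagram ::
    "nat \<Rightarrow> (nat \<Rightarrow> real \<times> real) \<Rightarrow> (nat \<Rightarrow> int) \<Rightarrow> (real \<times> real) set set \<Rightarrow> bool" where
  "RT_diagram n \<xi> a T \<longleftrightarrow>
     finite T \<and>
     (\<forall>R\<in>T. \<exists>v i j. 1 \<le> i \<and> i < j \<and> j \<le> n \<and> R = rhombus \<xi> v i j) \<and>
     \<Union>T = zonogon n \<xi> a \<and>
     (\<forall>R\<in>T. \<forall>S\<in>T. R \<inter> S face_of R \<and> R \<inter> S face_of S)"

definition diagram_vertices :: "(real \<times> real) set set \<Rightarrow> (real \<times> real) set" where
  "diagram_vertices T = {p. \<exists>R\<in>T. p extreme_point_of R}"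

end

theory Submission
  imports Defs
begin

text \<open>
  Fix coordinates in which all \<open>\<xi> i\<close> point upwards.  A word \<open>w\<close> in the colours \<open>1, \<dots>, n\<close> in which
  each \<open>i\<close> occurs \<open>a i\<close> times is an upward path from the bottom to the top of the zonogon, and
  exchanging two adjacent letters \<open>i j\<close> with \<open>i < j\<close> pushes this path to the right over one rhombus.
  The left and right boundaries are the increasing and the decreasing word, so that RT-diagrams
  correspond to chains of such flips between these two words, and the vertices of a diagram to
  the prefixes of the words in the chain.

  Along a chain a letter \<open>j\<close> that once precedes a smaller letter \<open>i\<close> does so forever.  For a violating
  pair \<open>x\<close>, \<open>x'\<close> the colours \<open>i, j\<close> therefore exclude that \<open>x\<close> comes first in the chain, and the
  colours \<open>j, k\<close> exclude that \<open>x'\<close> does.  Conversely, if there is no violating pair, then ``having to come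
  earlier in the chain'' is a strict partial order on \<open>X\<close>; repeatedly making flips towards a minimal
  vector that has not been reached yet never destroys the prefixes still needed.
\<close>

subsection \<open>Faces of convex sets\<close>

text \<open>The frame is tilted because the half-plane is closed: \<open>\<xi> 1\<close> or
  \<open>\<xi> n\<close> may be horizontal, so the second coordinate need not grow along a path. A
  diagram is a bare set of rhombi; colours and adjacency must be recovered from the common-face
  condition together with the distinctness of integer combinations, which makes a point determine
  the counts of the prefix leading to it and prevents a generator from being a diagonal of a tile.
  For a given diagram the obstacle is to find the next flip: two consecutive path edges must be the
  two left sides of one tile. For building a diagram it is the converse, that each new tile must
  meet all old ones in faces; so the recursion runs to the decreasing word, and tiles are glued to
  the left on the way back, along a path whose corners and edges fit every tile touching it.\<close>

lemma supporting_face: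
  fixes \<phi> :: "'a::real_vector \<Rightarrow> real"
  assumes "linear \<phi>" "convex S" "\<And>x. x \<in> S \<Longrightarrow> c \<le> \<phi> x"
  shows "S \<inter> {x. \<phi> x = c} face_of S"
  unfolding face_of_def
proof (intro conjI ballI impI)
  show "convex (S \<inter> {x. \<phi> x = c})"
    using assms(1,2)
    by (auto simp: convex_def linear_add linear_scale simp flip: distrib_right)
next
  fix p q x
  assume p: "p \<in> S" and q: "q \<in> S" and x: "x \<in> S \<inter> {x. \<phi> x = c}" "x \<in> open_segment p q"
  from x(2) obtain u where u: "0 < u" "u < 1" "x = (1 - u) *\<^sub>R p + u *\<^sub>R q"
    by (auto simp: in_segment)
  have eq: "(1 - u) * (\<phi> p - c) + u * (\<phi> q - c) = 0"
  proof -
    have "\<phi> x = (1 - u) * \<phi> p + u * \<phi> q"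
      unfolding u(3) using assms(1) by (simp add: linear_add linear_scale)
    with x(1) show ?thesis by (simp add: algebra_simps)
  qed
  have "0 \<le> (1 - u) * (\<phi> p - c)" "0 \<le> u * (\<phi> q - c)"
    using assms(3)[OF p] assms(3)[OF q] u by auto
  with eq have "(1 - u) * (\<phi> p - c) = 0" "u * (\<phi> q - c) = 0" by linarith+
  with u show "p \<in> S \<inter> {x. \<phi> x = c}" "q \<in> S \<inter> {x. \<phi> x = c}"
    using p q by auto
qed auto

text \<open>The face condition reduces to single points: if \<open>x\<close> lies in the open
  segment from \<open>p\<close> to \<open>q\<close> in \<open>R\<close> and \<open>G\<close> is a
  common face through \<open>x\<close>, then \<open>p\<close> and \<open>q\<close> lie in
  \<open>G\<close>, hence in \<open>S\<close>. In use, \<open>G\<close> is a corner or an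
  edge.\<close>

lemma Int_face_of_both:
  assumes "convex R" "convex S"
    and F: "\<And>p. p \<in> R \<Longrightarrow> p \<in> S \<Longrightarrow> \<exists>F. F face_of R \<and> F face_of S \<and> p \<in> F"
  shows "R \<inter> S face_of R" "R \<inter> S face_of S"
proof -
  have c: "convex (R \<inter> S)" using assms by (simp add: convex_Int)
  show "R \<inter> S face_of R"
    unfolding face_of_def
  proof (intro conjI ballI impI)
    fix p q x assume *: "p \<in> R" "q \<in> R" "x \<in> R \<inter> S" "x \<in> open_segment p q"
    then obtain G where "G face_of R" "G face_of S" "x \<in> G" using F by blast
    then have "p \<in> G" "q \<in> G" "G \<subseteq> S"
      using * face_ofD[of G R x p q] face_of_imp_subset[of G S] by auto
    then show "p \<in> R \<inter> S" "q \<in> R \<inter> S" using * by auto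
  qed (use c in auto)
  show "R \<inter> S face_of S"
    unfolding face_of_def
  proof (intro conjI ballI impI)
    fix p q x assume *: "p \<in> S" "q \<in> S" "x \<in> R \<inter> S" "x \<in> open_segment p q"
    then obtain G where "G face_of R" "G face_of S" "x \<in> G" using F by blast
    then have "p \<in> G" "q \<in> G" "G \<subseteq> R"
      using * face_ofD[of G S x p q] face_of_imp_subset[of G R] by auto
    then show "p \<in> R \<inter> S" "q \<in> R \<inter> S" using * by auto
  qed (use c in auto)
qed

lemma rhombus_commute: "rhombus \<xi> v i j = rhombus \<xi> v j i"
  unfolding rhombus_def by (auto simp: add.commute) (metis add.commute)+

lemma segment_face_extreme:
  fixes R :: "'a::euclidean_space set"
  assumes "closed_segment p q face_of R"
  shows "p extreme_point_of R" "q extreme_point_of R"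
  using extreme_point_of_face[OF assms, of p] extreme_point_of_face[OF assms, of q]
  by (simp_all add: extreme_point_of_segment)

subsection \<open>Words and flips\<close>

text \<open>Comparing the edges of a path before and after a flip comes down to these four positions
  of a letter; \<open>prefix_two_cases\<close> serves the same purpose for vertices.\<close>

lemma append_eq_two_cases:
  assumes "u' @ i' # v' = u @ x # y # v"
  shows "(\<exists>z. u = u' @ i' # z \<and> v' = z @ x # y # v) \<or> (u' = u \<and> i' = x \<and> v' = y # v) \<or>
    (u' = u @ [x] \<and> i' = y \<and> v' = v) \<or> (\<exists>z. u' = u @ x # y # z \<and> v = z @ i' # v')"
  using assms
proof (induction u arbitrary: u')
  case Nil
  then show ?case by (cases u'; cases "tl u'") auto
next
  case (Cons c u)
  show ?case
  proof (cases u')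
    case Nil
    then show ?thesis using Cons.prems by auto
  next
    case u': (Cons c' u'')
    then show ?thesis using Cons.prems Cons.IH[of u''] by auto
  qed
qed

lemma prefix_two_cases:
  assumes "u' @ v' = u @ x # y # v"
  shows "(\<exists>z. u = u' @ z \<and> v' = z @ x # y # v) \<or> (u' = u @ [x] \<and> v' = y # v) \<or>
    (\<exists>z. u' = u @ x # y # z \<and> v = z @ v')"
proof (cases v')
  case Nil
  then show ?thesis using assms by auto
next
  case (Cons c v'')
  then show ?thesis using append_eq_two_cases[of u' c v'' u x y v] assms by auto
qed

lemma ex_ascent:
  fixes w :: "nat list"
  assumes "\<not> sorted_wrt (\<ge>) w"
  obtains u i j v where "w = u @ i # j # v" "i < j"
proof -
  have "transp (\<lambda>x y :: nat. y \<le> x)" by (auto intro: transpI)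
  then have "\<not> (\<forall>k. Suc k < length w \<longrightarrow> w ! Suc k \<le> w ! k)"
    using assms sorted_wrt_iff_nth_Suc_transp[of "(\<ge>)" w] by blast
  then obtain k where k: "Suc k < length w" "w ! k < w ! Suc k" by (meson not_le)
  then have "w = take k w @ w ! k # w ! Suc k # drop (Suc (Suc k)) w"
    by (metis Cons_nth_drop_Suc Suc_lessD append_take_drop_id)
  with k that show thesis by blast
qed

text \<open>This is the sum of position times letter, positions counted from 0. Moving the larger
  letter of an ascent forward lowers it, which makes it the measure for both recursions along
  flips.\<close>

primrec weight :: "nat list \<Rightarrow> nat" where
  "weight [] = 0"
| "weight (i # w) = sum_list w + weight w"

lemma weight_swap: "i < j \<Longrightarrow> weight (u @ j # i # v) < weight (u @ i # j # v)"
  by (induction u) auto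

subsection \<open>Rhombi in sheared coordinates\<close>

text \<open>
  \<open>\<eta>\<close> is a height that increases along every \<open>\<xi> i\<close>, \<open>\<kappa>\<close> a horizontal coordinate, and \<open>\<delta>\<close> the
  horizontal unit vector.  The clockwise order of the vectors says that their inverse slopes
  increase.
\<close>

locale fan =
  fixes n :: nat and \<xi> :: "nat \<Rightarrow> real \<times> real"
    and \<eta> \<kappa> :: "real \<times> real \<Rightarrow> real" and \<delta> :: "real \<times> real"
    and a :: "nat \<Rightarrow> int"
  assumes two_le: "2 \<le> n"
    and lin_height: "linear \<eta>" and lin_abscissa: "linear \<kappa>"
    and coords_inj: "\<And>p. \<eta> p = 0 \<Longrightarrow> \<kappa> p = 0 \<Longrightarrow> p = 0"
    and height_\<delta> [simp]: "\<eta> \<delta> = 0" and abscissa_\<delta> [simp]: "\<kappa> \<delta> = 1"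
    and height_pos: "\<And>i. i \<in> {1..n} \<Longrightarrow> 0 < \<eta> (\<xi> i)"
    and slope_less: "\<And>i j. i \<in> {1..n} \<Longrightarrow> j \<in> {1..n} \<Longrightarrow> i < j \<Longrightarrow>
          \<kappa> (\<xi> i) / \<eta> (\<xi> i) < \<kappa> (\<xi> j) / \<eta> (\<xi> j)"
    and proj_inj: "inj_on (plane_proj n \<xi>) ({1..n} \<rightarrow>\<^sub>E UNIV)"
    and a_pos: "\<And>i. i \<in> {1..n} \<Longrightarrow> 0 < a i"
begin

lemmas height_simps [simp] =
  linear_add[OF lin_height] linear_diff[OF lin_height] linear_scale[OF lin_height]
  linear_0[OF lin_height] linear_sum[OF lin_height] linear_neg[OF lin_height]
lemmas abscissa_simps [simp] =
  linear_add[OF lin_abscissa] linear_diff[OF lin_abscissa] linear_scale[OF lin_abscissa]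
  linear_0[OF lin_abscissa] linear_sum[OF lin_abscissa] linear_neg[OF lin_abscissa]

lemma coords_eqI: "\<eta> p = \<eta> q \<Longrightarrow> \<kappa> p = \<kappa> q \<Longrightarrow> p = q"
  using coords_inj[of "p - q"] by simp

definition slope :: "nat \<Rightarrow> real" where
  "slope i = \<kappa> (\<xi> i) / \<eta> (\<xi> i)"

lemma slope_mono: "i \<in> {1..n} \<Longrightarrow> j \<in> {1..n} \<Longrightarrow> i < j \<Longrightarrow> slope i < slope j"
  unfolding slope_def by (rule slope_less)

lemma abscissa_gen: "i \<in> {1..n} \<Longrightarrow> \<kappa> (\<xi> i) = slope i * \<eta> (\<xi> i)"
  using height_pos[of i] by (simp add: slope_def)

lemma rhombusI:
  "0 \<le> s \<Longrightarrow> s \<le> 1 \<Longrightarrow> 0 \<le> t \<Longrightarrow> t \<le> 1 \<Longrightarrow> v + (s *\<^sub>R \<xi> i + t *\<^sub>R \<xi> j) \<in> rhombus \<xi> v i j"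
  unfolding rhombus_def by blast

text \<open>For \<open>p - v\<close> written with coefficients \<open>s\<close> and
  \<open>t\<close>, the four inequalities say in turn \<open>0 \<le> t\<close>,
  \<open>s \<le> 1\<close>, \<open>0 \<le> s\<close>, \<open>t \<le> 1\<close>. The first two bound
  the abscissa from the left and the last two from the right, the form in which tiles are compared
  with paths.\<close>

lemma rhombus_iff:
  assumes ij: "i \<in> {1..n}" "j \<in> {1..n}" "i < j"
  shows "p \<in> rhombus \<xi> v i j \<longleftrightarrow>
     slope i * (\<eta> p - \<eta> v) \<le> \<kappa> p - \<kappa> v \<and>
     slope j * (\<eta> p - \<eta> v) - \<eta> (\<xi> i) * (slope j - slope i) \<le> \<kappa> p - \<kappa> v \<and>
     \<kappa> p - \<kappa> v \<le> slope j * (\<eta> p - \<eta> v) \<and>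
     \<kappa> p - \<kappa> v \<le> slope i * (\<eta> p - \<eta> v) + \<eta> (\<xi> j) * (slope j - slope i)"
    (is "_ \<longleftrightarrow> ?C")
proof -
  define D where "D = slope j - slope i"
  have D: "0 < D" using slope_mono[OF ij] by (simp add: D_def)
  have hi: "0 < \<eta> (\<xi> i)" and hj: "0 < \<eta> (\<xi> j)" using height_pos ij by auto
  have ki: "\<kappa> (\<xi> i) = slope i * \<eta> (\<xi> i)" and kj: "\<kappa> (\<xi> j) = slope j * \<eta> (\<xi> j)"
    using abscissa_gen ij by auto
  show ?thesis
  proof
    assume "p \<in> rhombus \<xi> v i j"
    then obtain s t where st: "0 \<le> s" "s \<le> 1" "0 \<le> t" "t \<le> 1" "p = v + (s *\<^sub>R \<xi> i + t *\<^sub>R \<xi> j)"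
      unfolding rhombus_def by blast
    have "0 \<le> t * (\<eta> (\<xi> j) * D)" "t * (\<eta> (\<xi> j) * D) \<le> 1 * (\<eta> (\<xi> j) * D)"
      "0 \<le> s * (\<eta> (\<xi> i) * D)" "s * (\<eta> (\<xi> i) * D) \<le> 1 * (\<eta> (\<xi> i) * D)"
      using st D hi hj by (auto intro!: mult_nonneg_nonneg mult_right_mono)
    then show ?C
      unfolding st(5) by (simp add: ki kj D_def algebra_simps)
  next
    assume C: ?C
    \<comment> \<open>Cramer's rule for the two equations that height and abscissa of
      \<open>p - v\<close> impose on the coefficients.\<close>
    define s where "s = (slope j * (\<eta> p - \<eta> v) - (\<kappa> p - \<kappa> v)) / (\<eta> (\<xi> i) * D)"
    define t where "t = ((\<kappa> p - \<kappa> v) - slope i * (\<eta> p - \<eta> v)) / (\<eta> (\<xi> j) * D)"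
    have "0 < \<eta> (\<xi> i) * D" "0 < \<eta> (\<xi> j) * D" using D hi hj by auto
    then have st: "0 \<le> s" "s \<le> 1" "0 \<le> t" "t \<le> 1"
      using C unfolding s_def t_def D_def[symmetric] by auto
    have sD: "s * \<eta> (\<xi> i) = (slope j * (\<eta> p - \<eta> v) - (\<kappa> p - \<kappa> v)) / D"
      and tD: "t * \<eta> (\<xi> j) = ((\<kappa> p - \<kappa> v) - slope i * (\<eta> p - \<eta> v)) / D"
      using hi hj D by (simp_all add: s_def t_def)
    have "p = v + (s *\<^sub>R \<xi> i + t *\<^sub>R \<xi> j)"
    proof (rule coords_eqI)
      have "s * \<eta> (\<xi> i) + t * \<eta> (\<xi> j) = D * (\<eta> p - \<eta> v) / D"
        unfolding sD tD add_divide_distrib[symmetric] by (simp add: D_def algebra_simps)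
      then show "\<eta> p = \<eta> (v + (s *\<^sub>R \<xi> i + t *\<^sub>R \<xi> j))" using D by simp
      have "slope i * (s * \<eta> (\<xi> i)) + slope j * (t * \<eta> (\<xi> j)) = D * (\<kappa> p - \<kappa> v) / D"
        unfolding sD tD times_divide_eq_right add_divide_distrib[symmetric]
        by (simp add: D_def algebra_simps)
      also have "\<dots> = \<kappa> p - \<kappa> v" using D by simp
      finally show "\<kappa> p = \<kappa> (v + (s *\<^sub>R \<xi> i + t *\<^sub>R \<xi> j))" by (simp add: ki kj algebra_simps)
    qed
    then show "p \<in> rhombus \<xi> v i j" using st rhombusI by metis
  qed
qed

lemma rhombus_interiorI:
  assumes ij: "i \<in> {1..n}" "j \<in> {1..n}" "i < j"
    and "slope i * (\<eta> p - \<eta> v) < \<kappa> p - \<kappa> v"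
      "slope j * (\<eta> p - \<eta> v) - \<eta> (\<xi> i) * (slope j - slope i) < \<kappa> p - \<kappa> v"
      "\<kappa> p - \<kappa> v < slope j * (\<eta> p - \<eta> v)"
      "\<kappa> p - \<kappa> v < slope i * (\<eta> p - \<eta> v) + \<eta> (\<xi> j) * (slope j - slope i)"
  shows "p \<in> interior (rhombus \<xi> v i j)"
proof (rule interiorI)
  have [continuous_intros]: "continuous_on UNIV \<eta>" "continuous_on UNIV \<kappa>"
    using lin_height lin_abscissa by (simp_all add: linear_continuous_on linear_linear)
  let ?U = "{p. slope i * (\<eta> p - \<eta> v) < \<kappa> p - \<kappa> v} \<inter>
      {p. slope j * (\<eta> p - \<eta> v) - \<eta> (\<xi> i) * (slope j - slope i) < \<kappa> p - \<kappa> v} \<inter>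
      {p. \<kappa> p - \<kappa> v < slope j * (\<eta> p - \<eta> v)} \<inter>
      {p. \<kappa> p - \<kappa> v < slope i * (\<eta> p - \<eta> v) + \<eta> (\<xi> j) * (slope j - slope i)}"
  show "open ?U" by (intro open_Int open_Collect_less continuous_intros)
  show "p \<in> ?U" using assms by simp
  show "?U \<subseteq> rhombus \<xi> v i j" by (rule subsetI, subst rhombus_iff[OF ij]) simp
qed

lemma rhombus_eq_image:
  "rhombus \<xi> v i j = (\<lambda>q. v + (fst q *\<^sub>R \<xi> i + snd q *\<^sub>R \<xi> j)) ` ({0..1} \<times> {0..1})"
proof (intro equalityI subsetI)
  fix p assume "p \<in> rhombus \<xi> v i j"
  then obtain s t where "p = v + (s *\<^sub>R \<xi> i + t *\<^sub>R \<xi> j)" "(s, t) \<in> {0..1} \<times> {0..1}"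
    unfolding rhombus_def by auto
  then show "p \<in> (\<lambda>q. v + (fst q *\<^sub>R \<xi> i + snd q *\<^sub>R \<xi> j)) ` ({0..1} \<times> {0..1})"
    by (intro image_eqI[where x = "(s, t)"]) auto
qed (auto intro!: rhombusI)

lemma compact_rhombus: "compact (rhombus \<xi> v i j)"
  unfolding rhombus_eq_image
  by (intro compact_continuous_image continuous_intros compact_Times) auto

lemma convex_rhombus: "convex (rhombus \<xi> v i j)"
proof -
  have "rhombus \<xi> v i j = (+) v ` ((\<lambda>q. fst q *\<^sub>R \<xi> i + snd q *\<^sub>R \<xi> j) ` ({0..1} \<times> {0..1}))"
    unfolding rhombus_eq_image image_image ..
  moreover have "linear (\<lambda>q. fst q *\<^sub>R \<xi> i + snd q *\<^sub>R \<xi> j)"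
    by (rule linearI) (auto simp: algebra_simps)
  ultimately show ?thesis
    by (simp add: convex_translation convex_linear_image convex_Times)
qed

lemma rhombus_edge_faces:
  assumes ij: "i \<in> {1..n}" "j \<in> {1..n}" "i \<noteq> j"
  shows "closed_segment v (v + \<xi> i) face_of rhombus \<xi> v i j"
    and "closed_segment (v + \<xi> j) (v + \<xi> j + \<xi> i) face_of rhombus \<xi> v i j"
proof -
  \<comment> \<open>Vanishes along \<open>\<xi> i\<close>; the sign makes it positive on
    \<open>\<xi> j\<close> in either order of the colours, so that exchanging \<open>i\<close> and
    \<open>j\<close> yields the other two sides.\<close>
  define \<phi> where "\<phi> p = (if i < j then 1 else -1) * (\<kappa> p - slope i * \<eta> p)" for p
  have lin: "linear \<phi>"
    unfolding \<phi>_def by (rule linearI) (auto simp: algebra_simps)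
  have i0: "\<phi> (\<xi> i) = 0" using abscissa_gen ij by (simp add: \<phi>_def)
  have "\<phi> (\<xi> j) = (if i < j then 1 else -1) * (slope j - slope i) * \<eta> (\<xi> j)"
    using abscissa_gen ij by (simp add: \<phi>_def algebra_simps)
  then have j0: "0 < \<phi> (\<xi> j)"
    using slope_mono[of i j] slope_mono[of j i] ij height_pos[of j] by auto
  have \<phi>: "\<phi> (v + (s *\<^sub>R \<xi> i + t *\<^sub>R \<xi> j)) = \<phi> v + t * \<phi> (\<xi> j)" for s t
    using lin i0 by (simp add: linear_add linear_scale)
  have "rhombus \<xi> v i j \<inter> {p. \<phi> p = \<phi> v} face_of rhombus \<xi> v i j"
    by (rule supporting_face[OF lin convex_rhombus]) (use j0 \<phi> in \<open>auto simp: rhombus_def\<close>)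
  moreover have "rhombus \<xi> v i j \<inter> {p. \<phi> p = \<phi> v} = closed_segment v (v + \<xi> i)"
  proof (intro equalityI subsetI)
    fix p assume "p \<in> closed_segment v (v + \<xi> i)"
    then obtain s where s: "0 \<le> s" "s \<le> 1" "p = v + s *\<^sub>R \<xi> i"
      by (auto simp: closed_segment_def algebra_simps)
    show "p \<in> rhombus \<xi> v i j \<inter> {p. \<phi> p = \<phi> v}"
      using rhombusI[of s 0 v i j] \<phi>[of s 0] s by auto
  qed (use j0 \<phi> in \<open>auto simp: rhombus_def closed_segment_def algebra_simps\<close>)
  ultimately show "closed_segment v (v + \<xi> i) face_of rhombus \<xi> v i j" by simp
  have lin': "linear (\<lambda>p. - \<phi> p)" using lin by (simp add: linear_compose_neg)
  have "rhombus \<xi> v i j \<inter> {p. - \<phi> p = - \<phi> v - \<phi> (\<xi> j)} face_of rhombus \<xi> v i j"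
    by (rule supporting_face[OF lin' convex_rhombus]) (use j0 \<phi> in \<open>auto simp: rhombus_def\<close>)
  moreover have "rhombus \<xi> v i j \<inter> {p. - \<phi> p = - \<phi> v - \<phi> (\<xi> j)} = closed_segment (v + \<xi> j) (v + \<xi> j + \<xi> i)"
  proof (intro equalityI subsetI)
    fix p assume "p \<in> closed_segment (v + \<xi> j) (v + \<xi> j + \<xi> i)"
    then obtain s where s: "0 \<le> s" "s \<le> 1" "p = v + (s *\<^sub>R \<xi> i + \<xi> j)"
      by (auto simp: closed_segment_def algebra_simps)
    show "p \<in> rhombus \<xi> v i j \<inter> {p. - \<phi> p = - \<phi> v - \<phi> (\<xi> j)}"
      using rhombusI[of s 1 v i j] \<phi>[of s 1] s by auto
  qed (use j0 \<phi> in \<open>auto simp: rhombus_def closed_segment_def algebra_simps\<close>)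
  ultimately show "closed_segment (v + \<xi> j) (v + \<xi> j + \<xi> i) face_of rhombus \<xi> v i j" by simp
qed

lemma rhombus_extreme:
  assumes ij: "i \<in> {1..n}" "j \<in> {1..n}" "i \<noteq> j"
  shows "v extreme_point_of rhombus \<xi> v i j"
    and "v + \<xi> i extreme_point_of rhombus \<xi> v i j"
    and "v + \<xi> j extreme_point_of rhombus \<xi> v i j"
    and "v + \<xi> i + \<xi> j extreme_point_of rhombus \<xi> v i j"
  using rhombus_edge_faces[OF ij, of v] segment_face_extreme
  by (metis add.commute add.left_commute)+

lemma extreme_rhombusD:
  assumes ij: "i \<in> {1..n}" "j \<in> {1..n}" and p: "p extreme_point_of rhombus \<xi> v i j"
  shows "p \<in> {v, v + \<xi> i, v + \<xi> j, v + \<xi> i + \<xi> j}"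
proof -
  obtain s t where st: "0 \<le> s" "s \<le> 1" "0 \<le> t" "t \<le> 1" "p = v + (s *\<^sub>R \<xi> i + t *\<^sub>R \<xi> j)"
    using p unfolding extreme_point_of_def rhombus_def by blast
  have nz: "\<xi> i \<noteq> 0" "\<xi> j \<noteq> 0" using height_pos ij by force+
  have s: "s = 0 \<or> s = 1"
  proof (rule ccontr)
    assume c: "\<not> ?thesis"
    have "p \<in> open_segment (v + (0 *\<^sub>R \<xi> i + t *\<^sub>R \<xi> j)) (v + (1 *\<^sub>R \<xi> i + t *\<^sub>R \<xi> j))"
      unfolding in_segment using st c nz by (intro conjI exI[of _ s]) (auto simp: algebra_simps)
    moreover have "v + (0 *\<^sub>R \<xi> i + t *\<^sub>R \<xi> j) \<in> rhombus \<xi> v i j" "v + (1 *\<^sub>R \<xi> i + t *\<^sub>R \<xi> j) \<in> rhombus \<xi> v i j"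
      using st by (auto intro!: rhombusI simp del: scaleR_zero_left scaleR_one)
    ultimately show False using p unfolding extreme_point_of_def by blast
  qed
  have t: "t = 0 \<or> t = 1"
  proof (rule ccontr)
    assume c: "\<not> ?thesis"
    have "p \<in> open_segment (v + (s *\<^sub>R \<xi> i + 0 *\<^sub>R \<xi> j)) (v + (s *\<^sub>R \<xi> i + 1 *\<^sub>R \<xi> j))"
      unfolding in_segment using st c nz by (intro conjI exI[of _ t]) (auto simp: algebra_simps)
    moreover have "v + (s *\<^sub>R \<xi> i + 0 *\<^sub>R \<xi> j) \<in> rhombus \<xi> v i j" "v + (s *\<^sub>R \<xi> i + 1 *\<^sub>R \<xi> j) \<in> rhombus \<xi> v i j"
      using st by (auto intro!: rhombusI simp del: scaleR_zero_left scaleR_one)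
    ultimately show False using p unfolding extreme_point_of_def by blast
  qed
  show ?thesis using s t st by (auto simp: algebra_simps)
qed

text \<open>At the corner only the two left inequalities of \<open>rhombus_iff\<close> are tight,
  and a step to the right makes them strict; \<open>\<epsilon>\<close> is the slack of the two right
  ones.\<close>

lemma left_corner_interior:
  assumes ij: "i \<in> {1..n}" "j \<in> {1..n}" "i < j"
  shows "\<exists>\<epsilon>>0. \<forall>e. 0 < e \<and> e < \<epsilon> \<longrightarrow> v + \<xi> i + e *\<^sub>R \<delta> \<in> interior (rhombus \<xi> v i j)"
proof -
  have D: "0 < slope j - slope i" using slope_mono[OF ij] by simp
  have hi: "0 < \<eta> (\<xi> i)" and hj: "0 < \<eta> (\<xi> j)" using height_pos ij by auto
  define \<epsilon> where "\<epsilon> = min (\<eta> (\<xi> i) * (slope j - slope i)) (\<eta> (\<xi> j) * (slope j - slope i))"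
  have "0 < \<epsilon>" using D hi hj by (simp add: \<epsilon>_def)
  moreover have "v + \<xi> i + e *\<^sub>R \<delta> \<in> interior (rhombus \<xi> v i j)" if "0 < e" "e < \<epsilon>" for e
  proof (rule rhombus_interiorI[OF ij])
    show "slope i * (\<eta> (v + \<xi> i + e *\<^sub>R \<delta>) - \<eta> v) < \<kappa> (v + \<xi> i + e *\<^sub>R \<delta>) - \<kappa> v"
      using that abscissa_gen ij by simp
  qed (use that abscissa_gen ij in \<open>auto simp: \<epsilon>_def algebra_simps\<close>)
  ultimately show ?thesis by blast
qed

subsection \<open>Paths of words and the zonogon\<close>

definition pos :: "nat list \<Rightarrow> real \<times> real" where
  "pos u = sum_list (map \<xi> u)"

lemma pos_simps [simp]:
  "pos [] = 0" "pos (i # u) = \<xi> i + pos u" "pos (u @ v) = pos u + pos v"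
  by (simp_all add: pos_def)

text \<open>
  The path of a word, as the graph of a function that assigns to a height the horizontal
  coordinate; below and above the path it is continued by a constant.
\<close>

primrec path :: "nat list \<Rightarrow> real \<Rightarrow> real" where
  "path [] h = 0"
| "path (i # w) h = slope i * max 0 (min h (\<eta> (\<xi> i))) + path w (h - \<eta> (\<xi> i))"

lemma height_pos_nonneg: "set u \<subseteq> {1..n} \<Longrightarrow> 0 \<le> \<eta> (pos u)"
  by (induction u) (auto intro!: add_nonneg_nonneg less_imp_le[OF height_pos])

lemma path_nonpos: "set w \<subseteq> {1..n} \<Longrightarrow> h \<le> 0 \<Longrightarrow> path w h = 0"
proof (induction w arbitrary: h)
  case (Cons i w)
  have "0 < \<eta> (\<xi> i)" using height_pos[of i] Cons.prems by simp
  then have "path w (h - \<eta> (\<xi> i)) = 0" using Cons by auto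
  then show ?case using Cons.prems \<open>0 < \<eta> (\<xi> i)\<close> by simp
qed simp

lemma path_append: "path (u @ v) h = path u h + path v (h - \<eta> (pos u))"
  by (induction u arbitrary: h) (simp_all add: algebra_simps)

lemma path_top: "set w \<subseteq> {1..n} \<Longrightarrow> \<eta> (pos w) \<le> h \<Longrightarrow> path w h = \<kappa> (pos w)"
proof (induction w arbitrary: h)
  case (Cons i w)
  have i: "i \<in> {1..n}" and w: "set w \<subseteq> {1..n}" using Cons.prems by auto
  have "\<eta> (\<xi> i) \<le> h" using Cons.prems height_pos_nonneg[OF w] by simp
  moreover have "path w (h - \<eta> (\<xi> i)) = \<kappa> (pos w)" using Cons w by simp
  ultimately show ?case using height_pos[OF i] abscissa_gen[OF i] by simp
qed simp

lemma path_edge: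
  assumes "set (u @ i # v) \<subseteq> {1..n}" "0 \<le> s" "s \<le> 1"
  shows "path (u @ i # v) (\<eta> (pos u) + s * \<eta> (\<xi> i)) = \<kappa> (pos u) + s * \<kappa> (\<xi> i)"
proof -
  have i: "i \<in> {1..n}" and u: "set u \<subseteq> {1..n}" and v: "set v \<subseteq> {1..n}" using assms by auto
  have h: "0 < \<eta> (\<xi> i)" using height_pos[OF i] .
  have s: "0 \<le> s * \<eta> (\<xi> i)" "s * \<eta> (\<xi> i) \<le> \<eta> (\<xi> i)"
    using h assms(2,3) by (auto simp: mult_le_cancel_right1)
  have "path u (\<eta> (pos u) + s * \<eta> (\<xi> i)) = \<kappa> (pos u)" using s by (intro path_top[OF u]) simp
  moreover have "path v (s * \<eta> (\<xi> i) - \<eta> (\<xi> i)) = 0" using s by (intro path_nonpos[OF v]) simp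
  ultimately show ?thesis using s by (simp add: path_append abscissa_gen[OF i])
qed

lemma edge_at_height:
  assumes "set w \<subseteq> {1..n}" "w \<noteq> []" "0 \<le> h" "h \<le> \<eta> (pos w)"
  shows "\<exists>u i v s. w = u @ i # v \<and> 0 \<le> s \<and> s \<le> 1 \<and> h = \<eta> (pos u) + s * \<eta> (\<xi> i)"
  using assms
proof (induction w arbitrary: h)
  case (Cons i w)
  have i: "0 < \<eta> (\<xi> i)" using Cons.prems height_pos[of i] by simp
  show ?case
  proof (cases "h \<le> \<eta> (\<xi> i)")
    case True
    then have "0 \<le> h / \<eta> (\<xi> i)" "h / \<eta> (\<xi> i) \<le> 1" "h = \<eta> (pos []) + h / \<eta> (\<xi> i) * \<eta> (\<xi> i)"
      using Cons.prems i by auto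
    then show ?thesis by blast
  next
    case False
    then have "w \<noteq> []" using Cons.prems by auto
    then obtain u j v s where
      "w = u @ j # v" "0 \<le> s" "s \<le> 1" "h - \<eta> (\<xi> i) = \<eta> (pos u) + s * \<eta> (\<xi> j)"
      using Cons.IH[of "h - \<eta> (\<xi> i)"] Cons.prems False by auto
    then show ?thesis by (intro exI[of _ "i # u"] exI[of _ j] exI[of _ v] exI[of _ s]) auto
  qed
qed simp

lemma path_point:
  assumes w: "set w \<subseteq> {1..n}" "w \<noteq> []"
    and "0 \<le> \<eta> p" "\<eta> p \<le> \<eta> (pos w)" "\<kappa> p = path w (\<eta> p)"
  obtains u i v s where "w = u @ i # v" "0 \<le> s" "s \<le> 1" "p = pos u + s *\<^sub>R \<xi> i"
proof -
  obtain u i v s where *: "w = u @ i # v" "0 \<le> s" "s \<le> 1" "\<eta> p = \<eta> (pos u) + s * \<eta> (\<xi> i)"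
    using edge_at_height[OF w] assms by metis
  then have "\<kappa> p = \<kappa> (pos u) + s * \<kappa> (\<xi> i)"
    using path_edge[of u i v s] w assms by simp
  then have "p = pos u + s *\<^sub>R \<xi> i" using * by (intro coords_eqI) auto
  with * that show thesis by blast
qed

lemma continuous_path: "continuous_on UNIV (path w)"
proof (induction w)
  case (Cons i w)
  have "continuous_on UNIV (\<lambda>h. path w (h - \<eta> (\<xi> i)))"
    by (rule continuous_on_compose2[OF Cons]) (auto intro!: continuous_intros)
  then show ?case by (auto intro!: continuous_intros)
qed simp

section \<open>Flips: the two paths bound one rhombus\<close>

definition flip :: "nat list \<Rightarrow> nat list \<Rightarrow> bool" where
  "flip w w' \<longleftrightarrow> (\<exists>u i j v. i < j \<and> w = u @ i # j # v \<and> w' = u @ j # i # v)"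

context
  fixes u i j v
  assumes ij: "i < j" and set: "set (u @ i # j # v) \<subseteq> {1..n}"
begin

private lemma i: "i \<in> {1..n}" and j: "j \<in> {1..n}" and u: "set u \<subseteq> {1..n}" and v: "set v \<subseteq> {1..n}"
  using set by auto

private lemma hi: "0 < \<eta> (\<xi> i)" and hj: "0 < \<eta> (\<xi> j)"
  using height_pos i j by auto

private lemma slopes: "slope i < slope j" using slope_mono i j ij by auto

private lemma diff_eq:
  "path (u @ j # i # v) h - path (u @ i # j # v) h =
   path [j, i] (h - \<eta> (pos u)) - path [i, j] (h - \<eta> (pos u))"
  by (simp add: path_append algebra_simps)

lemma flip_outside:
  assumes "h \<le> \<eta> (pos u) \<or> \<eta> (pos u) + \<eta> (\<xi> i) + \<eta> (\<xi> j) \<le> h"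
  shows "path (u @ j # i # v) h = path (u @ i # j # v) h"
proof -
  have "path [j, i] (h - \<eta> (pos u)) = path [i, j] (h - \<eta> (pos u))"
    using assms hi hj by (auto simp: algebra_simps)
  then show ?thesis using diff_eq[of h] by simp
qed

text \<open>Over these heights the old path is the maximum of the two left bounds in
  \<open>rhombus_iff\<close>, and the new path the minimum of the two right bounds.\<close>

private lemma path_ij:
  assumes "\<eta> (pos u) \<le> h" "h \<le> \<eta> (pos u) + \<eta> (\<xi> i) + \<eta> (\<xi> j)"
  shows "path (u @ i # j # v) h = \<kappa> (pos u) + max (slope i * (h - \<eta> (pos u)))
        (slope j * (h - \<eta> (pos u)) - \<eta> (\<xi> i) * (slope j - slope i))"
    and "path (u @ j # i # v) h = \<kappa> (pos u) + min (slope j * (h - \<eta> (pos u)))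
        (slope i * (h - \<eta> (pos u)) + \<eta> (\<xi> j) * (slope j - slope i))"
proof -
  define t where "t = h - \<eta> (pos u)"
  have t: "0 \<le> t" "t \<le> \<eta> (\<xi> i) + \<eta> (\<xi> j)" using assms by (auto simp: t_def)
  have 1: "path u h = \<kappa> (pos u)" using assms by (intro path_top[OF u]) simp
  have 2: "path v (t - (\<eta> (\<xi> i) + \<eta> (\<xi> j))) = 0" using t by (intro path_nonpos[OF v]) simp
  have "path [i, j] t = max (slope i * t) (slope j * t - \<eta> (\<xi> i) * (slope j - slope i))"
  proof (cases "t \<le> \<eta> (\<xi> i)")
    case True
    then have "(slope j - slope i) * t \<le> (slope j - slope i) * \<eta> (\<xi> i)"
      using slopes by (intro mult_left_mono) auto
    then show ?thesis using True t hi hj by (simp add: algebra_simps max_def)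
  next
    case False
    then have "(slope j - slope i) * \<eta> (\<xi> i) \<le> (slope j - slope i) * t"
      using slopes by (intro mult_left_mono) auto
    then show ?thesis using False t hi hj by (simp add: algebra_simps max_def)
  qed
  moreover have "path (u @ i # j # v) h = path u h + (path [i, j] t + path v (t - (\<eta> (\<xi> i) + \<eta> (\<xi> j))))"
    by (simp add: path_append t_def algebra_simps)
  ultimately show "path (u @ i # j # v) h = \<kappa> (pos u) + max (slope i * (h - \<eta> (pos u)))
        (slope j * (h - \<eta> (pos u)) - \<eta> (\<xi> i) * (slope j - slope i))"
    using 1 2 by (simp add: t_def)
  have "path [j, i] t = min (slope j * t) (slope i * t + \<eta> (\<xi> j) * (slope j - slope i))"
  proof (cases "t \<le> \<eta> (\<xi> j)")
    case True
    then have "(slope j - slope i) * t \<le> (slope j - slope i) * \<eta> (\<xi> j)"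
      using slopes by (intro mult_left_mono) auto
    then show ?thesis using True t hi hj by (simp add: algebra_simps min_def)
  next
    case False
    then have "(slope j - slope i) * \<eta> (\<xi> j) \<le> (slope j - slope i) * t"
      using slopes by (intro mult_left_mono) auto
    then show ?thesis using False t hi hj by (simp add: algebra_simps min_def)
  qed
  moreover have "path (u @ j # i # v) h = path u h + (path [j, i] t + path v (t - (\<eta> (\<xi> i) + \<eta> (\<xi> j))))"
    by (simp add: path_append t_def algebra_simps)
  ultimately show "path (u @ j # i # v) h = \<kappa> (pos u) + min (slope j * (h - \<eta> (pos u)))
        (slope i * (h - \<eta> (pos u)) + \<eta> (\<xi> j) * (slope j - slope i))"
    using 1 2 by (simp add: t_def)
qed

lemma flip_inside:
  assumes h: "\<eta> (pos u) < h" "h < \<eta> (pos u) + \<eta> (\<xi> i) + \<eta> (\<xi> j)"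
  shows "path (u @ i # j # v) h < path (u @ j # i # v) h"
proof -
  have "slope i * (h - \<eta> (pos u)) < slope j * (h - \<eta> (pos u))"
    using slopes h by (intro mult_strict_right_mono) auto
  moreover have "(slope j - slope i) * (h - \<eta> (pos u)) < (slope j - slope i) * (\<eta> (\<xi> i) + \<eta> (\<xi> j))"
    using slopes h by (intro mult_strict_left_mono) auto
  moreover have "0 < \<eta> (\<xi> j) * (slope j - slope i)" "0 < \<eta> (\<xi> i) * (slope j - slope i)"
    using slopes hi hj by auto
  ultimately have "max (slope i * (h - \<eta> (pos u)))
        (slope j * (h - \<eta> (pos u)) - \<eta> (\<xi> i) * (slope j - slope i)) <
      min (slope j * (h - \<eta> (pos u)))
        (slope i * (h - \<eta> (pos u)) + \<eta> (\<xi> j) * (slope j - slope i))"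
    unfolding max_less_iff_conj min_less_iff_conj by (simp add: algebra_simps)
  then show ?thesis
    unfolding path_ij[OF less_imp_le[OF h(1)] less_imp_le[OF h(2)]] by (rule add_strict_left_mono)
qed

lemma flip_le: "path (u @ i # j # v) h \<le> path (u @ j # i # v) h"
  using flip_outside[of h] flip_inside[of h] by linarith

lemma flip_tile_iff:
  "p \<in> rhombus \<xi> (pos u) i j \<longleftrightarrow>
     \<eta> (pos u) \<le> \<eta> p \<and> \<eta> p \<le> \<eta> (pos u) + \<eta> (\<xi> i) + \<eta> (\<xi> j) \<and>
     path (u @ i # j # v) (\<eta> p) \<le> \<kappa> p \<and> \<kappa> p \<le> path (u @ j # i # v) (\<eta> p)"
proof -
  have "\<eta> (pos u) \<le> \<eta> p \<and> \<eta> p \<le> \<eta> (pos u) + \<eta> (\<xi> i) + \<eta> (\<xi> j)"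
    if "p \<in> rhombus \<xi> (pos u) i j"
  proof -
    \<comment> \<open>The range of heights is implicit in the four inequalities: chain a lower bound
      for the abscissa with an upper one.\<close>
    have "0 \<le> (slope j - slope i) * (\<eta> p - \<eta> (pos u))"
      "0 \<le> (slope j - slope i) * (\<eta> (\<xi> i) + \<eta> (\<xi> j) - (\<eta> p - \<eta> (pos u)))"
      using that unfolding rhombus_iff[OF i j ij] by (auto simp: algebra_simps)
    then show ?thesis using slopes by (auto simp: zero_le_mult_iff)
  qed
  then show ?thesis
    using path_ij[of "\<eta> p"] rhombus_iff[OF i j ij, of p "pos u"] by fastforce
qed

end

section \<open>Words as monotone paths inside the zonogon\<close>

lemma pos_count: "set u \<subseteq> {1..n} \<Longrightarrow> pos u = (\<Sum>i=1..n. real (count_list u i) *\<^sub>R \<xi> i)"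
proof (induction u)
  case (Cons i u)
  have "(\<Sum>k=1..n. real (count_list (i # u) k) *\<^sub>R \<xi> k) =
      (\<Sum>k=1..n. (if k = i then \<xi> k else 0) + real (count_list u k) *\<^sub>R \<xi> k)"
    by (intro sum.cong) (auto simp: algebra_simps)
  also have "\<dots> = \<xi> i + pos u" using Cons by (simp add: sum.distrib)
  finally show ?case by simp
qed simp

definition count_vec :: "nat list \<Rightarrow> nat \<Rightarrow> int" where
  "count_vec u = restrict (\<lambda>i. int (count_list u i)) {1..n}"

lemma pos_eq_proj: "set u \<subseteq> {1..n} \<Longrightarrow> pos u = plane_proj n \<xi> (count_vec u)"
  by (simp add: pos_count plane_proj_def count_vec_def)

text \<open>Distinctness of integer combinations in the form used for tiles. Colours outside
  \<open>{1..n}\<close> occur in neither word, so the count functions agree everywhere.\<close>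

lemma pos_injD:
  assumes u: "set u \<subseteq> {1..n}" "set u' \<subseteq> {1..n}" and eq: "pos u = pos u'"
  shows "count_list u = count_list u'"
proof
  fix i
  have "count_vec u = count_vec u'"
    using proj_inj eq u by (auto simp: pos_eq_proj inj_on_def count_vec_def)
  then have "count_vec u i = count_vec u' i" by simp
  then show "count_list u i = count_list u' i"
  proof (cases "i \<in> {1..n}")
    case False
    then have "i \<notin> set u" "i \<notin> set u'" using u by auto
    then show ?thesis by (simp add: count_list_0_iff)
  qed (auto simp: count_vec_def)
qed

definition word :: "nat list \<Rightarrow> bool" where
  "word w \<longleftrightarrow> set w \<subseteq> {1..n} \<and> (\<forall>i\<in>{1..n}. int (count_list w i) = a i)"

lemma word_count_full:
  assumes "word (u @ v)" "i \<in> {1..n}" "i \<notin> set v"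
  shows "int (count_list u i) = a i"
proof -
  have "int (count_list (u @ v) i) = a i" using assms(1,2) unfolding word_def by blast
  then show ?thesis using assms(3) by (simp add: count_list_0_iff)
qed

abbreviation Z :: "(real \<times> real) set" where
  "Z \<equiv> zonogon n \<xi> a"

lemma word_set: "word w \<Longrightarrow> set w \<subseteq> {1..n}"
  by (simp add: word_def)

lemma count_list_swap: "count_list (u @ j # i # v) = count_list (u @ i # j # v)"
  by (rule ext) simp

lemma word_swap: "word (u @ j # i # v) \<longleftrightarrow> word (u @ i # j # v)"
  unfolding word_def count_list_swap[of u j i v] by auto

lemma word_flip: "flip w w' \<Longrightarrow> word w' \<longleftrightarrow> word w"
  by (auto simp: flip_def word_swap)

lemma pos_word: "word w \<Longrightarrow> pos w = (\<Sum>i=1..n. real_of_int (a i) *\<^sub>R \<xi> i)"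
proof -
  assume w: "word w"
  have "real (count_list w i) = real_of_int (a i)" if "i \<in> {1..n}" for i
    using w that by (metis word_def of_int_of_nat_eq)
  then show ?thesis unfolding pos_count[OF word_set[OF w]] by (intro sum.cong) auto
qed

lemma word_nonempty: "word w \<Longrightarrow> w \<noteq> []"
  using a_pos[of 1] two_le by (auto simp: word_def)

lemma convex_Z: "convex Z"
  unfolding convex_def
proof (intro ballI allI impI)
  fix p q and s t :: real assume "p \<in> Z" "q \<in> Z" and st: "0 \<le> s" "0 \<le> t" "s + t = 1"
  then obtain l m where l: "p = (\<Sum>i=1..n. l i *\<^sub>R \<xi> i)" "\<forall>i\<in>{1..n}. 0 \<le> l i \<and> l i \<le> real_of_int (a i)"
    and m: "q = (\<Sum>i=1..n. m i *\<^sub>R \<xi> i)" "\<forall>i\<in>{1..n}. 0 \<le> m i \<and> m i \<le> real_of_int (a i)"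
    unfolding zonogon_def by blast
  have "s *\<^sub>R p + t *\<^sub>R q = (\<Sum>i=1..n. (s * l i + t * m i) *\<^sub>R \<xi> i)"
    by (simp add: l(1) m(1) scaleR_sum_right sum.distrib algebra_simps)
  moreover have "0 \<le> s * l i + t * m i \<and> s * l i + t * m i \<le> real_of_int (a i)" if "i \<in> {1..n}" for i
    using l(2) m(2) st that by (auto intro!: convex_bound_le)
  ultimately show "s *\<^sub>R p + t *\<^sub>R q \<in> Z"
    unfolding zonogon_def by (intro CollectI exI[of _ "\<lambda>i. s * l i + t * m i"]) simp
qed

text \<open>All generators have positive height, so an extreme height forces every coefficient;
  hence the lowest and the highest point are unique.\<close>

lemma height_Z:
  assumes "p \<in> Z" "word w"
  shows "0 \<le> \<eta> p" "\<eta> p \<le> \<eta> (pos w)" "\<eta> p = 0 \<Longrightarrow> p = 0" "\<eta> p = \<eta> (pos w) \<Longrightarrow> p = pos w"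
proof -
  obtain l where l: "p = (\<Sum>i=1..n. l i *\<^sub>R \<xi> i)" "\<forall>i\<in>{1..n}. 0 \<le> l i \<and> l i \<le> real_of_int (a i)"
    using assms(1) unfolding zonogon_def by blast
  have hp: "\<eta> p = (\<Sum>i=1..n. l i * \<eta> (\<xi> i))" by (simp add: l(1))
  have hw: "\<eta> (pos w) - \<eta> p = (\<Sum>i=1..n. (real_of_int (a i) - l i) * \<eta> (\<xi> i))"
    using pos_word[OF assms(2)] by (simp add: hp sum_subtractf algebra_simps)
  have 1: "0 \<le> l i * \<eta> (\<xi> i)" and 2: "0 \<le> (real_of_int (a i) - l i) * \<eta> (\<xi> i)" if "i \<in> {1..n}" for i
    using l(2) height_pos[OF that] that by auto
  show "0 \<le> \<eta> p" unfolding hp by (rule sum_nonneg[OF 1])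
  have "0 \<le> \<eta> (pos w) - \<eta> p" unfolding hw by (rule sum_nonneg[OF 2])
  then show "\<eta> p \<le> \<eta> (pos w)" by simp
  show "p = 0" if "\<eta> p = 0"
  proof -
    have "l i * \<eta> (\<xi> i) = 0" if "i \<in> {1..n}" for i
      using sum_nonneg_eq_0_iff[of "{1..n}" "\<lambda>i. l i * \<eta> (\<xi> i)"] 1 that \<open>\<eta> p = 0\<close> hp by auto
    then have "l i = 0" if "i \<in> {1..n}" for i using height_pos[of i] that by force
    then show ?thesis using l(1) by simp
  qed
  show "p = pos w" if "\<eta> p = \<eta> (pos w)"
  proof -
    have "(real_of_int (a i) - l i) * \<eta> (\<xi> i) = 0" if "i \<in> {1..n}" for i
      using sum_nonneg_eq_0_iff[of "{1..n}" "\<lambda>i. (real_of_int (a i) - l i) * \<eta> (\<xi> i)"] 2 that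
        \<open>\<eta> p = \<eta> (pos w)\<close> hw by auto
    then have "l i = real_of_int (a i)" if "i \<in> {1..n}" for i using height_pos[of i] that by force
    then show ?thesis using l(1) pos_word[OF assms(2)] by simp
  qed
qed

lemma pos_in_Z:
  assumes "word (u @ v)"
  shows "pos u \<in> Z"
proof -
  have "real (count_list u i) \<le> real_of_int (a i)" if "i \<in> {1..n}" for i
  proof -
    have "int (count_list u i) + int (count_list v i) = a i"
      using assms that by (auto simp: word_def)
    then have "int (count_list u i) \<le> a i" by linarith
    then show ?thesis by linarith
  qed
  then have "\<exists>l. pos u = (\<Sum>i=1..n. l i *\<^sub>R \<xi> i) \<and> (\<forall>i\<in>{1..n}. 0 \<le> l i \<and> l i \<le> real_of_int (a i))"
    using assms pos_count[of u] by (intro exI[of _ "\<lambda>i. real (count_list u i)"]) (auto simp: word_def)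
  then show ?thesis unfolding zonogon_def by blast
qed

lemma edge_in_Z:
  assumes "word (u @ i # v)" "0 \<le> s" "s \<le> 1"
  shows "pos u + s *\<^sub>R \<xi> i \<in> Z"
proof -
  have "pos u \<in> Z" "pos (u @ [i]) \<in> Z"
    using pos_in_Z[of u "i # v"] pos_in_Z[of "u @ [i]" v] assms by auto
  then have "(1 - s) *\<^sub>R pos u + s *\<^sub>R pos (u @ [i]) \<in> Z"
    using convexD[OF convex_Z] assms by simp
  then show ?thesis by (simp add: algebra_simps)
qed

lemma tile_in_Z:
  assumes w: "word (u @ i # j # v)"
  shows "rhombus \<xi> (pos u) i j \<subseteq> Z"
proof
  fix p assume "p \<in> rhombus \<xi> (pos u) i j"
  then obtain s t where st: "0 \<le> s" "s \<le> 1" "0 \<le> t" "t \<le> 1" and p: "p = pos u + (s *\<^sub>R \<xi> i + t *\<^sub>R \<xi> j)"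
    unfolding rhombus_def by blast
  have w': "word (u @ j # i # v)" using w word_swap by blast
  have "pos u + t *\<^sub>R \<xi> j \<in> Z" using edge_in_Z[OF w'] st by blast
  moreover have "pos (u @ [i]) + t *\<^sub>R \<xi> j \<in> Z" using edge_in_Z[of "u @ [i]" j v t] w st by simp
  ultimately have "(1 - s) *\<^sub>R (pos u + t *\<^sub>R \<xi> j) + s *\<^sub>R (pos (u @ [i]) + t *\<^sub>R \<xi> j) \<in> Z"
    using convexD[OF convex_Z] st by simp
  then show "p \<in> Z" by (simp add: p algebra_simps)
qed

text \<open>
  The zonogon lies on one side of the line through each edge of its boundary, and these edges
  are the edges of the monotone words.
\<close>

lemma sorted_supporting:
  assumes w: "word (u @ i # v)" and p: "p \<in> Z"
  shows "sorted (u @ i # v) \<Longrightarrow> \<kappa> (pos u) - slope i * \<eta> (pos u) \<le> \<kappa> p - slope i * \<eta> p"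
    and "sorted_wrt (\<ge>) (u @ i # v) \<Longrightarrow> \<kappa> p - slope i * \<eta> p \<le> \<kappa> (pos u) - slope i * \<eta> (pos u)"
proof -
  obtain l where l: "p = (\<Sum>i=1..n. l i *\<^sub>R \<xi> i)" "\<forall>i\<in>{1..n}. 0 \<le> l i \<and> l i \<le> real_of_int (a i)"
    using p unfolding zonogon_def by blast
  have i: "i \<in> {1..n}" and u: "set u \<subseteq> {1..n}" using w by (auto simp: word_def)
  \<comment> \<open>In a monotone word the colours on one side of \<open>i\<close> are used up in
    \<open>u\<close> and those on the other side have not occurred. This fixes the sign of both
    factors of \<open>f k\<close>, and all summands get the same sign.\<close>
  define f where "f k = (l k - real (count_list u k)) * ((slope k - slope i) * \<eta> (\<xi> k))" for k
  have "(\<kappa> p - slope i * \<eta> p) - (\<kappa> (pos u) - slope i * \<eta> (pos u)) =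
     (\<Sum>k=1..n. (l k - real (count_list u k)) * (\<kappa> (\<xi> k) - slope i * \<eta> (\<xi> k)))"
    by (simp add: l(1) pos_count[OF u] sum_subtractf sum_distrib_left sum.distrib algebra_simps)
  also have "\<dots> = (\<Sum>k=1..n. f k)"
    by (intro sum.cong refl) (simp add: f_def abscissa_gen algebra_simps)
  finally have eq: "(\<kappa> p - slope i * \<eta> p) - (\<kappa> (pos u) - slope i * \<eta> (pos u)) = (\<Sum>k=1..n. f k)" .
  have cnt: "real (count_list u k) = real_of_int (a k)" if "k \<in> {1..n}" "k \<notin> set (i # v)" for k
    using word_count_full[OF w that] by linarith
  have pos: "0 \<le> (slope k - slope i) * \<eta> (\<xi> k)" if "k \<in> {1..n}" "i \<le> k" for k
    using slope_mono[OF i that(1)] that height_pos[of k] by (cases "i = k") auto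
  have neg: "(slope k - slope i) * \<eta> (\<xi> k) \<le> 0" if "k \<in> {1..n}" "k \<le> i" for k
    using slope_mono[OF that(1) i] that height_pos[of k] by (cases "i = k") (auto simp: mult_le_0_iff)
  show "\<kappa> (pos u) - slope i * \<eta> (pos u) \<le> \<kappa> p - slope i * \<eta> p" if s: "sorted (u @ i # v)"
  proof -
    have "0 \<le> f k" if k: "k \<in> {1..n}" for k
    proof -
      consider "k < i" | "k = i" | "i < k" by linarith
      then show ?thesis
      proof cases
        case 1
        then have "k \<notin> set (i # v)" using s by (auto simp: sorted_append)
        then show ?thesis using cnt[OF k] l(2) k 1
          unfolding f_def by (intro mult_nonpos_nonpos[OF _ neg[OF k]]) auto
      next
        case 3
        then have "count_list u k = 0" using s by (auto simp: sorted_append count_list_0_iff)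
        then show ?thesis using l(2) k 3 unfolding f_def
          by (intro mult_nonneg_nonneg[OF _ pos[OF k]]) auto
      qed (simp add: f_def)
    qed
    then show ?thesis using eq sum_nonneg[of "{1..n}" f] by simp
  qed
  show "\<kappa> p - slope i * \<eta> p \<le> \<kappa> (pos u) - slope i * \<eta> (pos u)" if s: "sorted_wrt (\<ge>) (u @ i # v)"
  proof -
    have "f k \<le> 0" if k: "k \<in> {1..n}" for k
    proof -
      consider "k < i" | "k = i" | "i < k" by linarith
      then show ?thesis
      proof cases
        case 3
        then have "k \<notin> set (i # v)" using s by (auto simp: sorted_wrt_append)
        then show ?thesis using cnt[OF k] l(2) k 3
          unfolding f_def by (intro mult_nonpos_nonneg[OF _ pos[OF k]]) auto
      next
        case 1
        then have "count_list u k = 0" using s by (auto simp: sorted_wrt_append count_list_0_iff)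
        then show ?thesis using l(2) k 1 unfolding f_def
          by (intro mult_nonneg_nonpos[OF _ neg[OF k]]) auto
      qed (simp add: f_def)
    qed
    then show ?thesis using eq sum_nonpos[of "{1..n}" f] by simp
  qed
qed

lemma sorted_bound:
  assumes w: "word w" and p: "p \<in> Z"
  shows "sorted w \<Longrightarrow> path w (\<eta> p) \<le> \<kappa> p"
    and "sorted_wrt (\<ge>) w \<Longrightarrow> \<kappa> p \<le> path w (\<eta> p)"
proof -
  obtain u i v s where *: "w = u @ i # v" "0 \<le> s" "s \<le> 1" "\<eta> p = \<eta> (pos u) + s * \<eta> (\<xi> i)"
    using edge_at_height[of w "\<eta> p"] word_set[OF w] word_nonempty[OF w] height_Z[OF p w] by metis
  have i: "i \<in> {1..n}" using w * by (auto simp: word_def)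
  have "path w (\<eta> p) = \<kappa> (pos u) + slope i * (\<eta> p - \<eta> (pos u))"
    using path_edge[of u i v s] word_set[OF w] * by (simp add: abscissa_gen[OF i])
  then show "sorted w \<Longrightarrow> path w (\<eta> p) \<le> \<kappa> p" "sorted_wrt (\<ge>) w \<Longrightarrow> \<kappa> p \<le> path w (\<eta> p)"
    using sorted_supporting[of u i v p] w p * by (auto simp: algebra_simps)
qed

subsection \<open>Vertices and edges of a path\<close>

lemma weight_flip: "flip w w' \<Longrightarrow> weight w' < weight w"
  by (auto simp: flip_def weight_swap)

definition left_of :: "nat list \<Rightarrow> (real \<times> real) set" where
  "left_of w = {p. \<kappa> p \<le> path w (\<eta> p)}"

definition right_of :: "nat list \<Rightarrow> (real \<times> real) set" where
  "right_of w = {p. path w (\<eta> p) \<le> \<kappa> p}"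

definition path_vertices :: "nat list \<Rightarrow> (real \<times> real) set" where
  "path_vertices w = {pos u | u v. w = u @ v}"

abbreviation edge :: "nat list \<Rightarrow> nat \<Rightarrow> (real \<times> real) set" where
  "edge u i \<equiv> closed_segment (pos u) (pos u + \<xi> i)"

lemma gen_nonzero: "i \<in> {1..n} \<Longrightarrow> \<xi> i \<noteq> 0"
  using height_pos[of i] by auto

lemma gen_inj:
  assumes "i \<in> {1..n}" "j \<in> {1..n}" "\<xi> i = \<xi> j"
  shows "i = j"
proof -
  have "count_list [i] = count_list [j]" using assms by (intro pos_injD) auto
  then have "count_list [i] i = count_list [j] i" by simp
  then show ?thesis by (simp split: if_splits)
qed

text \<open>Equal lengths do not exclude this relation: three unit vectors at successive angles of
  60 degrees satisfy it, the middle one being a diagonal of the rhombus of the others.\<close>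

lemma gen_ne_add:
  "i \<in> {1..n} \<Longrightarrow> j \<in> {1..n} \<Longrightarrow> k \<in> {1..n} \<Longrightarrow> \<xi> i \<noteq> \<xi> j + \<xi> k"
proof
  assume *: "i \<in> {1..n}" "j \<in> {1..n}" "k \<in> {1..n}" "\<xi> i = \<xi> j + \<xi> k"
  then have "count_list [i] = count_list [j, k]" by (intro pos_injD) auto
  then have "count_list [i] j = count_list [j, k] j" "count_list [i] k = count_list [j, k] k" by auto
  then show False by (auto split: if_splits)
qed

lemma gen_add_nonzero:
  assumes "i \<in> {1..n}" "j \<in> {1..n}"
  shows "\<xi> i + \<xi> j \<noteq> 0"
proof
  assume "\<xi> i + \<xi> j = 0"
  then have "\<eta> (\<xi> i) + \<eta> (\<xi> j) = 0" by (metis height_simps(1,4))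
  then show False using height_pos assms by (metis add_pos_pos less_irrefl)
qed

text \<open>Only the end points matter: both are corners of the tile, and two corners that differ by
  \<open>\<xi> i\<close> can only span a side of colour \<open>i\<close>.\<close>

lemma rhombus_edge_cases:
  assumes i: "i \<in> {1..n}" and kl: "k \<in> {1..n}" "l \<in> {1..n}"
    and e: "closed_segment p (p + \<xi> i) face_of rhombus \<xi> b k l"
  shows "i = k \<and> (p = b \<or> p = b + \<xi> l) \<or> i = l \<and> (p = b \<or> p = b + \<xi> k)"
proof -
  define x where "x = p - b"
  have p: "p = b + x" by (simp add: x_def)
  have "p \<in> {b, b + \<xi> k, b + \<xi> l, b + \<xi> k + \<xi> l}" "p + \<xi> i \<in> {b, b + \<xi> k, b + \<xi> l, b + \<xi> k + \<xi> l}"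
    using extreme_rhombusD[OF kl] segment_face_extreme[OF e] by blast+
  then have x: "x \<in> {0, \<xi> k, \<xi> l, \<xi> k + \<xi> l}" and xi: "x + \<xi> i \<in> {0, \<xi> k, \<xi> l, \<xi> k + \<xi> l}"
    by (auto simp: p add.assoc)
  have pos: "0 < \<eta> (\<xi> i)" "0 < \<eta> (\<xi> k)" "0 < \<eta> (\<xi> l)" using height_pos i kl by auto
  consider "x = 0" | "x = \<xi> k" | "x = \<xi> l" | "x = \<xi> k + \<xi> l" using x by blast
  then show ?thesis
  proof cases
    case 1
    then have "\<xi> i = \<xi> k \<or> \<xi> i = \<xi> l"
      using xi gen_nonzero[OF i] gen_ne_add[OF i kl] by auto
    then show ?thesis using gen_inj i kl 1 p by auto
  next
    case 2
    have "\<xi> i = \<xi> l"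
      using xi 2 gen_nonzero[OF i] gen_add_nonzero[OF kl(1) i] gen_ne_add[OF kl(2) kl(1) i] by auto
    then show ?thesis using gen_inj i kl 2 p by auto
  next
    case 3
    have "\<xi> i = \<xi> k"
      using xi 3 gen_nonzero[OF i] gen_add_nonzero[OF kl(2) i] gen_ne_add[OF kl(1) kl(2) i] by (auto simp: add.commute)
    then show ?thesis using gen_inj i kl 3 p by auto
  next
    case 4
    have "\<eta> (x + \<xi> i) \<in> {0, \<eta> (\<xi> k), \<eta> (\<xi> l), \<eta> (\<xi> k) + \<eta> (\<xi> l)}"
      using xi by fastforce
    then show ?thesis using 4 pos by auto
  qed
qed

text \<open>The bound on \<open>c\<close> keeps the displaced midpoint at a height of the edge
  itself, where the path is straight; the sign of the product decides the side. This excludes tiles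
  that have the edge as a right side.\<close>

lemma left_of_edge:
  assumes w: "set (u @ i # v) \<subseteq> {1..n}" and k: "k \<in> {1..n}"
    and c: "\<bar>c\<bar> * \<eta> (\<xi> k) \<le> \<eta> (\<xi> i) / 2" "c * (slope k - slope i) < 0"
  shows "pos u + (1 / 2) *\<^sub>R \<xi> i + c *\<^sub>R \<xi> k \<notin> right_of (u @ i # v)"
proof -
  have i: "i \<in> {1..n}" using w by auto
  define s where "s = 1 / 2 + c * \<eta> (\<xi> k) / \<eta> (\<xi> i)"
  have hi: "0 < \<eta> (\<xi> i)" and hk: "0 < \<eta> (\<xi> k)" using height_pos i k by auto
  have "\<bar>c * \<eta> (\<xi> k)\<bar> \<le> \<eta> (\<xi> i) / 2" using c(1) hk by (simp add: abs_mult)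
  then have "\<bar>c * \<eta> (\<xi> k) / \<eta> (\<xi> i)\<bar> \<le> 1 / 2" using hi by (simp add: abs_divide field_simps)
  then have s: "0 \<le> s" "s \<le> 1" unfolding s_def by linarith+
  have sh: "s * \<eta> (\<xi> i) = \<eta> (\<xi> i) / 2 + c * \<eta> (\<xi> k)" using hi by (simp add: s_def field_simps)
  have "path (u @ i # v) (\<eta> (pos u) + s * \<eta> (\<xi> i)) = \<kappa> (pos u) + slope i * (s * \<eta> (\<xi> i))"
    using path_edge[OF w s] abscissa_gen[OF i] by simp
  moreover have "c * (slope k - slope i) * \<eta> (\<xi> k) < 0" using c(2) hk by (simp add: mult_neg_pos)
  ultimately show ?thesis
    unfolding right_of_def sh by (simp add: abscissa_gen[OF i] abscissa_gen[OF k] sh algebra_simps)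
qed

text \<open>The points that are not on the right boundary of the zonogon.\<close>

definition ahead :: "real \<times> real \<Rightarrow> bool" where
  "ahead p \<longleftrightarrow> (\<exists>e>0. p + e *\<^sub>R \<delta> \<in> Z)"

lemma left_corner_ahead:
  assumes "i \<in> {1..n}" "j \<in> {1..n}" "i < j" "rhombus \<xi> b i j \<subseteq> Z"
  shows "ahead (b + \<xi> i)"
proof -
  obtain \<epsilon> where "0 < \<epsilon>" "\<forall>e. 0 < e \<and> e < \<epsilon> \<longrightarrow> b + \<xi> i + e *\<^sub>R \<delta> \<in> interior (rhombus \<xi> b i j)"
    using left_corner_interior[OF assms(1-3)] by blast
  then have "b + \<xi> i + (\<epsilon> / 2) *\<^sub>R \<delta> \<in> interior (rhombus \<xi> b i j)" "0 < \<epsilon> / 2" by simp_all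
  then have "b + \<xi> i + (\<epsilon> / 2) *\<^sub>R \<delta> \<in> Z" "0 < \<epsilon> / 2"
    using assms(4) interior_subset[of "rhombus \<xi> b i j"] by blast+
  then show ?thesis unfolding ahead_def by blast
qed

lemma not_ahead_ends:
  assumes "word w"
  shows "\<not> ahead 0" "\<not> ahead (pos w)"
proof -
  have "\<delta> \<noteq> 0" using abscissa_\<delta> by fastforce
  moreover have "e *\<^sub>R \<delta> = 0" if "e *\<^sub>R \<delta> \<in> Z" for e
    using height_Z(3)[OF that assms] by simp
  moreover have "pos w + e *\<^sub>R \<delta> = pos w" if "pos w + e *\<^sub>R \<delta> \<in> Z" for e
    using height_Z(4)[OF that assms] by simp
  ultimately show "\<not> ahead 0" "\<not> ahead (pos w)" unfolding ahead_def by fastforce+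
qed

text \<open>By convexity: averaging one shifted end point with the other end point gives the
  midpoint shifted by half as much.\<close>

lemma ahead_midpoint:
  assumes w: "word (u @ i # v)" and a: "ahead (pos u) \<or> ahead (pos u + \<xi> i)"
  shows "ahead (pos u + (1 / 2) *\<^sub>R \<xi> i)"
proof -
  have "pos u \<in> Z" "pos u + \<xi> i \<in> Z" using edge_in_Z[OF w, of 0] edge_in_Z[OF w, of 1] by auto
  moreover obtain e where "0 < e" "pos u + e *\<^sub>R \<delta> \<in> Z \<or> pos u + \<xi> i + e *\<^sub>R \<delta> \<in> Z"
    using a unfolding ahead_def by blast
  ultimately obtain x y where xy: "x \<in> Z" "y \<in> Z" "x + y = 2 *\<^sub>R pos u + \<xi> i + e *\<^sub>R \<delta>"
  proof (elim disjE)
    assume "pos u + e *\<^sub>R \<delta> \<in> Z"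
    then show ?thesis using \<open>pos u + \<xi> i \<in> Z\<close> that[of "pos u + e *\<^sub>R \<delta>" "pos u + \<xi> i"]
      by (simp add: scaleR_2 algebra_simps)
  next
    assume "pos u + \<xi> i + e *\<^sub>R \<delta> \<in> Z"
    then show ?thesis using \<open>pos u \<in> Z\<close> that[of "pos u" "pos u + \<xi> i + e *\<^sub>R \<delta>"]
      by (simp add: scaleR_2 algebra_simps)
  qed
  have "(1 / 2) *\<^sub>R x + (1 / 2) *\<^sub>R y \<in> Z" using convexD[OF convex_Z] xy by simp
  moreover have "(1 / 2) *\<^sub>R x + (1 / 2) *\<^sub>R y = pos u + (1 / 2) *\<^sub>R \<xi> i + (e / 2) *\<^sub>R \<delta>"
    unfolding scaleR_add_right[symmetric] xy(3) by (simp add: algebra_simps)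
  ultimately show ?thesis using \<open>0 < e\<close> unfolding ahead_def by (intro exI[of _ "e / 2"]) simp
qed

end

subsection \<open>Sweeping a diagram from left to right\<close>

locale tiling = fan +
  fixes T :: "(real \<times> real) set set"
  assumes RT: "RT_diagram n \<xi> a T"
begin

lemma finite_tiles: "finite T" and Union_tiles: "\<Union>T = Z"
  and face_Int: "R \<in> T \<Longrightarrow> S \<in> T \<Longrightarrow> R \<inter> S face_of R" "R \<in> T \<Longrightarrow> S \<in> T \<Longrightarrow> R \<inter> S face_of S"
  using RT by (auto simp: RT_diagram_def)

lemma tile_obtain:
  assumes "R \<in> T"
  obtains b i j where "i \<in> {1..n}" "j \<in> {1..n}" "i < j" "R = rhombus \<xi> b i j"
proof -
  have "\<forall>R\<in>T. \<exists>b i j. 1 \<le> i \<and> i < j \<and> j \<le> n \<and> R = rhombus \<xi> b i j"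
    using RT by (simp add: RT_diagram_def)
  from bspec[OF this assms]
  obtain b i j where "1 \<le> i \<and> i < j \<and> j \<le> n \<and> R = rhombus \<xi> b i j"
    by (elim exE)
  then show thesis using that[of i j b] by simp
qed

lemma tile_facts:
  assumes "R \<in> T"
  shows "convex R" "closed R" "R \<subseteq> Z" "interior R \<noteq> {}"
proof -
  obtain b i j where ij: "i \<in> {1..n}" "j \<in> {1..n}" "i < j" and R: "R = rhombus \<xi> b i j"
    using tile_obtain[OF assms] .
  show "convex R" "closed R"
    unfolding R by (rule convex_rhombus, rule compact_imp_closed, rule compact_rhombus)
  show "R \<subseteq> Z" using assms Union_tiles by auto
  show "interior R \<noteq> {}"
  proof -
    obtain \<epsilon> where "0 < \<epsilon>" "\<forall>e. 0 < e \<and> e < \<epsilon> \<longrightarrow> b + \<xi> i + e *\<^sub>R \<delta> \<in> interior R"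
      using left_corner_interior[OF ij] R by blast
    then have "b + \<xi> i + (\<epsilon> / 2) *\<^sub>R \<delta> \<in> interior R" by simp
    then show ?thesis by blast
  qed
qed

text \<open>A convex subset of \<open>S\<close> whose relative interior meets the face
  \<open>S \<inter> R\<close> lies in that face. So \<open>e\<close> is a face of the common face,
  and then of \<open>R\<close>.\<close>

lemma face_transfer:
  assumes "S \<in> T" "R \<in> T" and e: "e face_of S" and q: "q \<in> rel_interior e" "q \<in> R"
  shows "e face_of R"
proof -
  have "q \<in> e" using q rel_interior_subset by blast
  moreover have eS: "e \<subseteq> S" using e face_of_imp_subset by blast
  ultimately have "e \<subseteq> S \<inter> R"
    using subset_of_face_of[OF face_Int(1)[OF assms(1,2)] eS] q by auto
  then have "e face_of S \<inter> R" using e face_of_subset[of e S "S \<inter> R"] by blast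
  then show ?thesis using face_of_trans face_Int(2)[OF assms(1,2)] by blast
qed

lemma extreme_transfer:
  assumes "S \<in> T" "R \<in> T" "p extreme_point_of S" "p \<in> R"
  shows "p extreme_point_of R"
  using face_transfer[of S R "{p}" p] assms by (simp add: face_of_singleton)

text \<open>A face that meets the interior is the whole set.\<close>

lemma tile_unique:
  assumes "R \<in> T" "S \<in> T" "interior R \<inter> interior S \<noteq> {}"
  shows "R = S"
proof -
  have "R \<inter> S = R" "R \<inter> S = S"
    using face_of_disjoint_interior[OF face_Int(1)[OF assms(1,2)]]
      face_of_disjoint_interior[OF face_Int(2)[OF assms(1,2)]] assms(3) interior_subset by blast+
  then show ?thesis by blast
qed

text \<open>The invariant of the sweep. Through its last condition, \<open>face_transfer\<close>
  recognises a path edge as a side of every tile that contains the midpoint of the edge.\<close>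

definition sweep_path :: "nat list \<Rightarrow> bool" where
  "sweep_path w \<longleftrightarrow> word w \<and> (\<forall>R\<in>T. R \<subseteq> left_of w \<or> R \<subseteq> right_of w) \<and>
     (\<forall>u i v. w = u @ i # v \<longrightarrow> (\<exists>S\<in>T. edge u i face_of S))"

text \<open>Points just to the right of the midpoint lie in tiles that are not left of the path;
  these are finitely many closed sets, so one of them contains the midpoint and has the edge as a
  side. If it were a right side, parts of the tile would lie left of the path.\<close>

lemma edge_tile:
  assumes w: "sweep_path (u @ i # v)" and a: "ahead (pos u + (1 / 2) *\<^sub>R \<xi> i)"
  shows "(\<exists>j\<in>{1..n}. i < j \<and> rhombus \<xi> (pos u) i j \<in> T) \<or>
         (\<exists>j\<in>{1..n}. j < i \<and> rhombus \<xi> (pos u - \<xi> j) j i \<in> T)"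
proof -
  define w where "w = u @ i # v"
  define q where "q = pos u + (1 / 2) *\<^sub>R \<xi> i"
  have word: "word w" using assms(1) by (simp add: sweep_path_def w_def)
  have set: "set (u @ i # v) \<subseteq> {1..n}" and i: "i \<in> {1..n}"
    using word_set[OF word] by (auto simp: w_def)
  have qZ: "q \<in> Z" unfolding q_def using edge_in_Z[of u i v "1/2"] word by (simp add: w_def)
  have kq: "\<kappa> q = path w (\<eta> q)"
    using path_edge[OF set, of "1/2"] by (simp add: q_def w_def)
  obtain e0 where e0: "0 < e0" "q + e0 *\<^sub>R \<delta> \<in> Z" using a by (auto simp: ahead_def q_def)
  define U where "U = \<Union>{S \<in> T. \<not> S \<subseteq> left_of w}"
  have "closed U" unfolding U_def using finite_tiles tile_facts(2) by (intro closed_Union) auto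
  have inU: "q + (e0 * t) *\<^sub>R \<delta> \<in> U" if t: "0 < t" "t \<le> 1" for t
  proof -
    have "(1 - t) *\<^sub>R q + t *\<^sub>R (q + e0 *\<^sub>R \<delta>) \<in> Z" using convexD[OF convex_Z] qZ e0 t by simp
    then have "q + (e0 * t) *\<^sub>R \<delta> \<in> \<Union>T" by (simp add: Union_tiles algebra_simps)
    moreover have "q + (e0 * t) *\<^sub>R \<delta> \<notin> left_of w" using kq mult_pos_pos[OF e0(1) t(1)] by (simp add: left_of_def)
    ultimately show ?thesis unfolding U_def by blast
  qed
  have "(\<lambda>k. q + (e0 * (1 / real (Suc k))) *\<^sub>R \<delta>) \<longlonglongrightarrow> q + (e0 * 0) *\<^sub>R \<delta>"
    by (intro tendsto_intros LIMSEQ_Suc[OF lim_1_over_n])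
  then have "q \<in> U"
    using closed_sequentially[OF \<open>closed U\<close>, of "\<lambda>k. q + (e0 * (1 / real (Suc k))) *\<^sub>R \<delta>" "q + (e0 * 0) *\<^sub>R \<delta>"]
      inU[of "1 / real (Suc _)"] by (simp del: of_nat_Suc)
  then obtain S where S: "S \<in> T" "q \<in> S" "\<not> S \<subseteq> left_of w" unfolding U_def by blast
  then have right: "S \<subseteq> right_of (u @ i # v)" using w by (auto simp: sweep_path_def w_def)
  obtain S0 where "S0 \<in> T" "edge u i face_of S0" using w unfolding sweep_path_def by blast
  moreover have "q \<in> rel_interior (edge u i)"
  proof -
    have "q = (1 - 1 / 2) *\<^sub>R pos u + (1 / 2) *\<^sub>R (pos u + \<xi> i)"
      by (simp add: q_def algebra_simps flip: scaleR_add_left)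
    then have "q \<in> open_segment (pos u) (pos u + \<xi> i)"
      unfolding in_segment using gen_nonzero[OF i] by (intro conjI exI[of _ "1/2"]) auto
    then show ?thesis using gen_nonzero[OF i] by (simp add: rel_interior_closed_segment)
  qed
  ultimately have e: "edge u i face_of S" using face_transfer S by blast
  obtain b k l where kl: "k \<in> {1..n}" "l \<in> {1..n}" "k < l" and Sr: "S = rhombus \<xi> b k l"
    using tile_obtain[OF S(1)] .
  \<comment> \<open>Length of a step into the tile: at most 1, to stay in the rhombus, and short
    enough for \<open>left_of_edge\<close>.\<close>
  define t where "t m = min (1 / 2) (\<eta> (\<xi> i) / 2 / \<eta> (\<xi> m))" for m
  have t: "0 < t m" "t m \<le> 1" "\<bar>t m\<bar> * \<eta> (\<xi> m) \<le> \<eta> (\<xi> i) / 2" "\<bar>- t m\<bar> * \<eta> (\<xi> m) \<le> \<eta> (\<xi> i) / 2"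
    if "m \<in> {1..n}" for m
  proof -
    have h: "0 < \<eta> (\<xi> m)" "0 < \<eta> (\<xi> i)" using height_pos i that by auto
    then show 1: "0 < t m" "t m \<le> 1" by (auto simp: t_def)
    have "t m * \<eta> (\<xi> m) \<le> \<eta> (\<xi> i) / 2 / \<eta> (\<xi> m) * \<eta> (\<xi> m)"
      using h by (intro mult_right_mono) (auto simp: t_def)
    then show "\<bar>t m\<bar> * \<eta> (\<xi> m) \<le> \<eta> (\<xi> i) / 2" "\<bar>- t m\<bar> * \<eta> (\<xi> m) \<le> \<eta> (\<xi> i) / 2" using h 1 by auto
  qed
  consider "i = k" "pos u = b" | "i = k" "pos u = b + \<xi> l" | "i = l" "pos u = b" | "i = l" "pos u = b + \<xi> k"
    using rhombus_edge_cases[OF i kl(1,2) e[unfolded Sr]] by blast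
  then show ?thesis
  proof cases
    case 1
    then show ?thesis using S Sr kl by auto
  next
    case 2
    have "pos u + (1 / 2) *\<^sub>R \<xi> i + (- t l) *\<^sub>R \<xi> l = b + ((1 / 2) *\<^sub>R \<xi> k + (1 - t l) *\<^sub>R \<xi> l)"
      by (simp add: 2 algebra_simps)
    also have "\<dots> \<in> S" unfolding Sr using t[OF kl(2)] by (intro rhombusI) auto
    finally have "pos u + (1 / 2) *\<^sub>R \<xi> i + (- t l) *\<^sub>R \<xi> l \<in> right_of (u @ i # v)" using right by blast
    moreover have "(- t l) * (slope l - slope i) < 0" using t[OF kl(2)] slope_mono[OF kl] 2 by simp
    ultimately show ?thesis using left_of_edge[OF set kl(2) t(4)[OF kl(2)]] by blast
  next
    case 3
    have "pos u + (1 / 2) *\<^sub>R \<xi> i + t k *\<^sub>R \<xi> k = b + (t k *\<^sub>R \<xi> k + (1 / 2) *\<^sub>R \<xi> l)"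
      by (simp add: 3 algebra_simps)
    also have "\<dots> \<in> S" unfolding Sr using t[OF kl(1)] by (intro rhombusI) auto
    finally have "pos u + (1 / 2) *\<^sub>R \<xi> i + t k *\<^sub>R \<xi> k \<in> right_of (u @ i # v)" using right by blast
    moreover have "t k * (slope k - slope i) < 0"
      using t[OF kl(1)] slope_mono[OF kl] 3 by (simp add: mult_pos_neg)
    ultimately show ?thesis using left_of_edge[OF set kl(1) t(3)[OF kl(1)]] by blast
  next
    case 4
    then show ?thesis using S Sr kl by auto
  qed
qed

text \<open>Two tiles with the same left corner overlap immediately to the right of it.\<close>

lemma corner_tile:
  assumes ij: "i \<in> {1..n}" "j \<in> {1..n}"
    and k: "k \<in> {1..n}" "i < k" "rhombus \<xi> b i k \<in> T"
    and l: "l \<in> {1..n}" "l < j" "rhombus \<xi> (b + \<xi> i - \<xi> l) l j \<in> T"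
  shows "i < j \<and> rhombus \<xi> b i j \<in> T"
proof -
  obtain e1 where e1: "0 < e1" "\<And>e. 0 < e \<Longrightarrow> e < e1 \<Longrightarrow> b + \<xi> i + e *\<^sub>R \<delta> \<in> interior (rhombus \<xi> b i k)"
    using left_corner_interior[OF ij(1) k(1,2)] by blast
  obtain e2 where e2: "0 < e2" "\<And>e. 0 < e \<Longrightarrow> e < e2 \<Longrightarrow>
      b + \<xi> i - \<xi> l + \<xi> l + e *\<^sub>R \<delta> \<in> interior (rhombus \<xi> (b + \<xi> i - \<xi> l) l j)"
    using left_corner_interior[OF l(1) ij(2) l(2)] by blast
  have "b + \<xi> i + (min e1 e2 / 2) *\<^sub>R \<delta> \<in> interior (rhombus \<xi> b i k) \<inter> interior (rhombus \<xi> (b + \<xi> i - \<xi> l) l j)"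
    using e1 e2 by (auto simp: algebra_simps)
  then have eq: "rhombus \<xi> (b + \<xi> i - \<xi> l) l j = rhombus \<xi> b i k" using tile_unique k l by blast
  \<comment> \<open>The two tiles coincide; their top corner shows that \<open>j\<close> is the
    second colour \<open>k\<close>.\<close>
  have "b + \<xi> i - \<xi> l + \<xi> l + \<xi> j extreme_point_of rhombus \<xi> b i k"
    using rhombus_extreme(4)[of l j "b + \<xi> i - \<xi> l"] l ij unfolding eq by auto
  from extreme_rhombusD[OF ij(1) k(1) this]
  have "\<xi> i + \<xi> j \<in> {0, \<xi> i, \<xi> k, \<xi> i + \<xi> k}" by (auto simp: algebra_simps)
  then have "\<xi> j = \<xi> k"
    using gen_nonzero[OF ij(2)] gen_add_nonzero[OF ij] gen_ne_add[OF k(1) ij] by (auto simp: add.assoc)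
  then have "j = k" using gen_inj ij k by blast
  then show ?thesis using k by simp
qed

text \<open>
  Every edge off the right boundary is the lower left (\<open>L\<close>) or the upper left (\<open>U\<close>) edge of a tile.
  The edge following the last one of kind \<open>L\<close> has kind \<open>U\<close>, and both belong to the same tile.
\<close>

lemma flip_tile_exists:
  assumes w: "sweep_path w" and d: "\<not> sorted_wrt (\<ge>) w"
  obtains u i j v where "w = u @ i # j # v" "i < j" "rhombus \<xi> (pos u) i j \<in> T"
proof -
  have word: "word w" using w by (simp add: sweep_path_def)
  define N where "N = length w"
  define P where "P k \<longleftrightarrow> ahead (pos (take k w))" for k
  define L where "L k \<longleftrightarrow> k < N \<and> (\<exists>j\<in>{1..n}. w ! k < j \<and> rhombus \<xi> (pos (take k w)) (w ! k) j \<in> T)" for k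
  define U where "U k \<longleftrightarrow> k < N \<and> (\<exists>j\<in>{1..n}. j < w ! k \<and> rhombus \<xi> (pos (take k w) - \<xi> j) j (w ! k) \<in> T)" for k
  have split: "w = take k w @ w ! k # drop (Suc k) w" if "k < N" for k
    using that id_take_nth_drop by (auto simp: N_def)
  have col: "w ! k \<in> {1..n}" if "k < N" for k
    using word_set[OF word] nth_mem[of k w] that unfolding N_def by blast
  have pos_Suc: "pos (take (Suc k) w) = pos (take k w) + \<xi> (w ! k)" if "k < N" for k
    using that by (simp add: take_Suc_conv_app_nth N_def)
  have LU: "L k \<or> U k" if k: "k < N" "P k \<or> P (Suc k)" for k
  proof -
    have "ahead (pos (take k w) + (1 / 2) *\<^sub>R \<xi> (w ! k))"
      using ahead_midpoint[of "take k w" "w ! k" "drop (Suc k) w"] split[OF k(1)] k word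
      by (simp add: P_def pos_Suc)
    then show ?thesis
      using edge_tile[of "take k w" "w ! k" "drop (Suc k) w"] split[OF k(1)] w k by (auto simp: L_def U_def)
  qed
  have LP: "P (Suc k)" if "L k" for k
  proof -
    obtain j where "j \<in> {1..n}" "w ! k < j" "rhombus \<xi> (pos (take k w)) (w ! k) j \<in> T" "k < N"
      using \<open>L k\<close> by (auto simp: L_def)
    then show ?thesis
      using left_corner_ahead[of "w ! k" j] col tile_facts(3) by (simp add: P_def pos_Suc)
  qed
  have UP: "P k" if "U k" for k
  proof -
    obtain j where "j \<in> {1..n}" "j < w ! k" "rhombus \<xi> (pos (take k w) - \<xi> j) j (w ! k) \<in> T" "k < N"
      using \<open>U k\<close> by (auto simp: U_def)
    then show ?thesis
      using left_corner_ahead[of j "w ! k" "pos (take k w) - \<xi> j"] col tile_facts(3) by (simp add: P_def)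
  qed
  obtain u i j v where asc: "w = u @ i # j # v" "i < j" using ex_ascent[OF d] .
  have "i \<in> {1..n}" "j \<in> {1..n}" using asc word_set[OF word] by auto
  then have "ahead (pos u + \<xi> i)"
    using left_corner_ahead[of i j "pos u"] tile_in_Z[of u i j v] asc word by auto
  moreover have "take (Suc (length u)) w = u @ [i]" by (simp add: asc)
  ultimately have Pu: "P (Suc (length u))" by (simp add: P_def add.commute)
  \<comment> \<open>The edge just below the first vertex that is \<open>ahead\<close> cannot have
    kind \<open>U\<close>, since its lower end would then be \<open>ahead\<close> too. So some edge
    has kind \<open>L\<close>.\<close>
  define m where "m = (LEAST k. P k)"
  have Pm: "P m" unfolding m_def using Pu by (rule LeastI)
  have "m \<le> Suc (length u)" unfolding m_def using Pu by (rule Least_le)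
  then have mN: "m \<le> N" by (simp add: N_def asc)
  have "m \<noteq> 0" using Pm not_ahead_ends(1)[OF word] by (intro notI) (simp add: P_def)
  then obtain m' where m': "m = Suc m'" by (cases m) auto
  then have "\<not> P m'" using not_less_Least[of m' P] by (simp add: m_def)
  then have "L m'" using LU[of m'] UP Pm m' mN by auto
  have "finite {k. L k}" by (rule finite_subset[of _ "{..<N}"]) (auto simp: L_def)
  define K where "K = Max {k. L k}"
  have LK: "L K" using Max_in[OF \<open>finite {k. L k}\<close>] \<open>L m'\<close> by (auto simp: K_def)
  have "\<not> L (Suc K)" using Max_ge[OF \<open>finite {k. L k}\<close>, of "Suc K"] by (auto simp: K_def)
  \<comment> \<open>The upper end of an edge of kind \<open>L\<close> is \<open>ahead\<close>, but
    the top of the zonogon is not.\<close>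
  have "Suc K \<noteq> N" using LP[OF LK] not_ahead_ends[OF word] by (auto simp: P_def N_def)
  then have SK: "Suc K < N" using LK by (auto simp: L_def)
  then have UK: "U (Suc K)" using LU[of "Suc K"] LP[OF LK] \<open>\<not> L (Suc K)\<close> by auto
  obtain k where k: "k \<in> {1..n}" "w ! K < k" "rhombus \<xi> (pos (take K w)) (w ! K) k \<in> T"
    using LK by (auto simp: L_def)
  obtain l where l: "l \<in> {1..n}" "l < w ! Suc K" "rhombus \<xi> (pos (take K w) + \<xi> (w ! K) - \<xi> l) l (w ! Suc K) \<in> T"
    using UK SK by (auto simp: U_def pos_Suc)
  have "w ! K < w ! Suc K \<and> rhombus \<xi> (pos (take K w)) (w ! K) (w ! Suc K) \<in> T"
    using corner_tile[OF _ _ k l] col SK by simp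
  moreover have "w = take K w @ w ! K # w ! Suc K # drop (Suc (Suc K)) w"
    using SK by (metis Cons_nth_drop_Suc N_def Suc_lessD append_take_drop_id)
  ultimately show thesis using that by blast
qed

text \<open>The region between the two paths is this one tile. Three of its corners are vertices of
  the old path and the fourth, \<open>pos u + \<xi> j\<close>, is on the new one, so no diagram
  vertex is skipped.\<close>

lemma sweep_flip:
  assumes w: "sweep_path (u @ i # j # v)" and ij: "i < j" and R: "rhombus \<xi> (pos u) i j \<in> T"
  shows "sweep_path (u @ j # i # v)"
    and "p \<in> diagram_vertices T \<Longrightarrow> p \<in> right_of (u @ i # j # v) \<Longrightarrow>
         p \<in> right_of (u @ j # i # v) \<or> p \<in> path_vertices (u @ i # j # v)"
proof -
  let ?w = "u @ i # j # v" and ?w' = "u @ j # i # v" and ?R = "rhombus \<xi> (pos u) i j"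
  have word: "word ?w" using w by (simp add: sweep_path_def)
  note set = word_set[OF word]
  have i: "i \<in> {1..n}" and j: "j \<in> {1..n}" using set by auto
  have inR: "p \<in> ?R" and inside: "\<eta> (pos u) < \<eta> p" "\<eta> p < \<eta> (pos u) + \<eta> (\<xi> i) + \<eta> (\<xi> j)"
    if "p \<in> right_of ?w" "\<kappa> p < path ?w' (\<eta> p)" for p
  proof -
    show "\<eta> (pos u) < \<eta> p" "\<eta> p < \<eta> (pos u) + \<eta> (\<xi> i) + \<eta> (\<xi> j)"
      using flip_outside[OF ij set, of "\<eta> p"] that by (auto simp: right_of_def not_le[symmetric])
    then show "p \<in> ?R" using flip_tile_iff[OF ij set] that by (simp add: right_of_def)
  qed
  show "sweep_path ?w'"
    unfolding sweep_path_def
  proof (intro conjI ballI allI impI)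
    show "word ?w'" using word word_swap by blast
  next
    fix S assume S: "S \<in> T"
    show "S \<subseteq> left_of ?w' \<or> S \<subseteq> right_of ?w'"
    proof (cases "S = ?R \<or> S \<subseteq> left_of ?w")
      case True
      then have "S \<subseteq> left_of ?w'"
        using flip_tile_iff[OF ij set] flip_le[OF ij set] by (auto simp: left_of_def intro: order_trans)
      then show ?thesis ..
    next
      case False
      then have right: "S \<subseteq> right_of ?w" using w S by (auto simp: sweep_path_def)
      have "p \<in> right_of ?w'" if p: "p \<in> S" for p
      proof (rule ccontr)
        assume "p \<notin> right_of ?w'"
        then have k: "\<kappa> p < path ?w' (\<eta> p)" by (simp add: right_of_def)
        define O' where "O' = {q. \<kappa> q < path ?w' (\<eta> q)}"
        have [continuous_intros]: "continuous_on UNIV \<eta>" "continuous_on UNIV \<kappa>"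
          using lin_height lin_abscissa by (simp_all add: linear_continuous_on linear_linear)
        have "continuous_on UNIV (\<lambda>q. path ?w' (\<eta> q))"
          by (rule continuous_on_compose2[OF continuous_path]) (auto intro!: continuous_intros)
        then have opn: "open O'" unfolding O'_def by (intro open_Collect_less continuous_intros)
        \<comment> \<open>A tile is the closure of its interior, so one reaching left of the new
          path would overlap the interior of \<open>?R\<close>.\<close>
        have "S = closure (interior S)"
          using tile_facts[OF S] convex_closure_interior[of S] by simp
        then have "p \<in> closure (interior S)" using p by blast
        then have "O' \<inter> interior S \<noteq> {}"
          using opn k open_Int_closure_eq_empty[of O' "interior S"] by (auto simp: O'_def)
        moreover have "O' \<inter> interior S \<subseteq> ?R"
          using inR right interior_subset[of S] by (auto simp: O'_def)
        then have "O' \<inter> interior S \<subseteq> interior ?R"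
          using opn by (intro interior_maximal) auto
        ultimately have "interior ?R \<inter> interior S \<noteq> {}" by blast
        then show False using tile_unique[OF R S] False by blast
      qed
      then show ?thesis by blast
    qed
  next
    fix u' i' v' assume eq: "?w' = u' @ i' # v'"
    show "\<exists>S\<in>T. edge u' i' face_of S"
      using append_eq_two_cases[OF eq[symmetric]]
    proof (elim disjE exE conjE)
      fix z assume "u = u' @ i' # z"
      then have "?w = u' @ i' # (z @ i # j # v)" by simp
      then show ?thesis using w unfolding sweep_path_def by blast
    next
      assume "u' = u" "i' = j"
      then show ?thesis
        using R rhombus_edge_faces(1)[of j i "pos u"] i j ij rhombus_commute[of \<xi> "pos u" i j] by auto
    next
      assume "u' = u @ [j]" "i' = i"
      then show ?thesis using R rhombus_edge_faces(2)[of i j "pos u"] i j ij by auto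
    next
      fix z assume z: "u' = u @ j # i # z" "v = z @ i' # v'"
      then have "?w = (u @ i # j # z) @ i' # v'" by simp
      then obtain S where "S \<in> T" "edge (u @ i # j # z) i' face_of S" using w unfolding sweep_path_def by blast
      then show ?thesis using z by (auto simp: algebra_simps)
    qed
  qed
  show "p \<in> right_of ?w' \<or> p \<in> path_vertices ?w"
    if p: "p \<in> diagram_vertices T" "p \<in> right_of ?w"
  proof (cases "p \<in> right_of ?w'")
    case nr: False
    then have k: "\<kappa> p < path ?w' (\<eta> p)" by (simp add: right_of_def)
    have ext: "p extreme_point_of ?R"
      using p(1) extreme_transfer[OF _ R _ inR[OF p(2) k]] unfolding diagram_vertices_def by blast
    consider "p = pos u" | "p = pos (u @ [i])" | "p = pos u + \<xi> j" | "p = pos (u @ [i, j])"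
      using extreme_rhombusD[OF i j ext] by (auto simp: add.assoc)
    then have "p \<in> path_vertices ?w"
    proof cases
      case 1
      then show ?thesis unfolding path_vertices_def by blast
    next
      case 2
      have "?w = (u @ [i]) @ j # v" by simp
      then show ?thesis using 2 unfolding path_vertices_def by blast
    next
      case 3
      have "set ?w' \<subseteq> {1..n}" using set by auto
      then have "p \<in> right_of ?w'" using path_edge[of u j "i # v" 1] 3 by (simp add: right_of_def)
      then show ?thesis using nr by blast
    next
      case 4
      have "?w = (u @ [i, j]) @ v" by simp
      then show ?thesis using 4 unfolding path_vertices_def by blast
    qed
    then show ?thesis ..
  qed simp
qed

text \<open>Some tile contains \<open>pos u\<close> and a short initial piece of the edge, and
  \<open>pos u\<close> is a corner of it. Since \<open>\<phi>\<close> is minimal on the zonogon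
  along the edge, the piece must run along a side at this corner.\<close>

lemma boundary_edge:
  assumes w: "word (u @ i # v)" "sorted (u @ i # v)"
    and S0: "S0 \<in> T" "pos u extreme_point_of S0"
  shows "\<exists>S\<in>T. edge u i face_of S"
proof -
  have i: "i \<in> {1..n}" using word_set[OF w(1)] by auto
  define U where "U = \<Union>{S \<in> T. pos u \<notin> S}"
  have "closed U" unfolding U_def using finite_tiles tile_facts(2) by (intro closed_Union) auto
  then have "open (- U)" "pos u \<in> - U" by (auto simp: U_def)
  then obtain \<epsilon> where \<epsilon>: "0 < \<epsilon>" "ball (pos u) \<epsilon> \<subseteq> - U" by (meson open_contains_ball)
  define s where "s = min 1 (\<epsilon> / 2 / norm (\<xi> i))"
  have ni: "0 < norm (\<xi> i)" using gen_nonzero[OF i] by simp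
  then have s: "0 < s" "s \<le> 1" using \<epsilon> by (auto simp: s_def)
  have "s * norm (\<xi> i) \<le> \<epsilon> / 2 / norm (\<xi> i) * norm (\<xi> i)"
    unfolding s_def by (intro mult_right_mono) auto
  then have "s * norm (\<xi> i) < \<epsilon>" using ni \<epsilon> by simp
  then have "pos u + s *\<^sub>R \<xi> i \<in> ball (pos u) \<epsilon>" using s by (simp add: dist_norm)
  then have "pos u + s *\<^sub>R \<xi> i \<notin> U" using \<epsilon>(2) by blast
  moreover have "pos u + s *\<^sub>R \<xi> i \<in> \<Union>T" unfolding Union_tiles using edge_in_Z[OF w(1)] s by simp
  ultimately obtain S where S: "S \<in> T" "pos u \<in> S" "pos u + s *\<^sub>R \<xi> i \<in> S" unfolding U_def by blast
  obtain b k l where kl: "k \<in> {1..n}" "l \<in> {1..n}" "k < l" and Sr: "S = rhombus \<xi> b k l"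
    using tile_obtain[OF S(1)] .
  define \<phi> where "\<phi> p = \<kappa> p - slope i * \<eta> p" for p
  have \<phi>_lin: "\<phi> (p + (c *\<^sub>R x + d *\<^sub>R y)) = \<phi> p + (c * \<phi> x + d * \<phi> y)" for p c x d y
    by (simp add: \<phi>_def algebra_simps)
  have min: "\<phi> (pos u) \<le> \<phi> p" if "p \<in> S" for p
    using sorted_supporting(1)[OF w(1) _ w(2), of p] tile_facts(3)[OF S(1)] that by (auto simp: \<phi>_def)
  have \<phi>0: "\<phi> (\<xi> m) = 0 \<longleftrightarrow> m = i" if "m \<in> {1..n}" for m
  proof -
    have "\<phi> (\<xi> m) = (slope m - slope i) * \<eta> (\<xi> m)" by (simp add: \<phi>_def abscissa_gen[OF that] algebra_simps)
    then show ?thesis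
      using slope_mono[OF i that] slope_mono[OF that i] height_pos[OF that] by (cases m i rule: linorder_cases) auto
  qed
  have "pos u \<in> {b, b + \<xi> k, b + \<xi> l, b + \<xi> k + \<xi> l}"
    using extreme_rhombusD[OF kl(1,2)] extreme_transfer[OF S0(1) S(1) S0(2) S(2)] Sr by blast
  then have "\<exists>c\<in>{0, 1}. \<exists>d\<in>{0, 1}. pos u = b + (c *\<^sub>R \<xi> k + d *\<^sub>R \<xi> l)"
    by (auto simp: add.assoc)
  then obtain c d where cd: "c \<in> {0, 1}" "d \<in> {0, 1}" and pu: "pos u = b + (c *\<^sub>R \<xi> k + d *\<^sub>R \<xi> l)"
    by blast
  obtain c' d' where cd': "0 \<le> c'" "c' \<le> 1" "0 \<le> d'" "d' \<le> 1"
    and px: "pos u + s *\<^sub>R \<xi> i = b + (c' *\<^sub>R \<xi> k + d' *\<^sub>R \<xi> l)"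
    using S(3) unfolding Sr rhombus_def by blast
  \<comment> \<open>Changing a single coordinate stays in \<open>S\<close>, so minimality makes each
    contribution to \<open>\<phi>\<close> nonnegative; they add up to 0, so both vanish.\<close>
  have mk: "0 \<le> (c' - c) * \<phi> (\<xi> k)"
  proof -
    have "b + (c' *\<^sub>R \<xi> k + d *\<^sub>R \<xi> l) \<in> S" unfolding Sr using cd cd' by (intro rhombusI) auto
    from min[OF this] show ?thesis unfolding pu \<phi>_lin by (simp add: algebra_simps)
  qed
  have ml: "0 \<le> (d' - d) * \<phi> (\<xi> l)"
  proof -
    have "b + (c *\<^sub>R \<xi> k + d' *\<^sub>R \<xi> l) \<in> S" unfolding Sr using cd cd' by (intro rhombusI) auto
    from min[OF this] show ?thesis unfolding pu \<phi>_lin by (simp add: algebra_simps)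
  qed
  have "\<phi> (pos u + s *\<^sub>R \<xi> i) = \<phi> (pos u)" by (simp add: \<phi>_def abscissa_gen[OF i] algebra_simps)
  then have "(c' - c) * \<phi> (\<xi> k) + (d' - d) * \<phi> (\<xi> l) = 0"
    unfolding px \<phi>_lin using \<phi>_lin[of b c "\<xi> k" d "\<xi> l"] pu by (simp add: algebra_simps)
  then have z: "(c' - c) * \<phi> (\<xi> k) = 0" "(d' - d) * \<phi> (\<xi> l) = 0" using mk ml by linarith+
  have diff: "s *\<^sub>R \<xi> i = (c' - c) *\<^sub>R \<xi> k + (d' - d) *\<^sub>R \<xi> l"
  proof -
    have "s *\<^sub>R \<xi> i = (pos u + s *\<^sub>R \<xi> i) - pos u" by simp
    also have "\<dots> = (b + (c' *\<^sub>R \<xi> k + d' *\<^sub>R \<xi> l)) - (b + (c *\<^sub>R \<xi> k + d *\<^sub>R \<xi> l))"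
      by (simp only: px) (simp only: pu)
    finally show ?thesis by (simp add: algebra_simps)
  qed
  have nz: "s *\<^sub>R \<xi> i \<noteq> 0" using s gen_nonzero[OF i] by simp
  have "k = i \<or> l = i" using z diff nz \<phi>0[OF kl(1)] \<phi>0[OF kl(2)] by auto
  then show ?thesis
  proof
    assume k: "k = i"
    then have "d' = d" using z(2) \<phi>0[OF kl(2)] kl by auto
    then have "s = c' - c" using diff k gen_nonzero[OF i] by (simp add: scaleR_cancel_right)
    then have "c = 0" using cd cd' s by auto
    then have "edge u i face_of S"
      using rhombus_edge_faces[OF kl(1,2), of b] kl cd(2) pu k Sr by (auto simp: add.assoc)
    then show ?thesis using S by blast
  next
    assume l: "l = i"
    then have "c' = c" using z(1) \<phi>0[OF kl(1)] kl by auto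
    then have "s = d' - d" using diff l gen_nonzero[OF i] by (simp add: scaleR_cancel_right)
    then have "d = 0" using cd cd' s by auto
    then have "edge u i face_of S"
      using rhombus_edge_faces[OF kl(2,1), of b] kl cd(1) pu l Sr rhombus_commute[of \<xi> b k l] by (auto simp: add.assoc)
    then show ?thesis using S by blast
  qed
qed

text \<open>Climbs the left boundary: a corner yields the next edge by \<open>boundary_edge\<close>,
  and its upper end is the next corner. The start is the unique lowest point of the zonogon.\<close>

lemma boundary_vertex:
  assumes "word (u @ v)" "sorted (u @ v)"
  shows "\<exists>S\<in>T. pos u extreme_point_of S"
  using assms
proof (induction u arbitrary: v rule: rev_induct)
  case Nil
  then have "0 \<in> \<Union>T" unfolding Union_tiles using pos_in_Z[of "[]" v] by simp
  then obtain S where S: "S \<in> T" "0 \<in> S" by blast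
  have "0 extreme_point_of S"
    unfolding extreme_point_of_def
  proof (intro conjI ballI notI)
    fix p q assume pq: "p \<in> S" "q \<in> S" "0 \<in> open_segment p q"
    then have Z: "p \<in> Z" "q \<in> Z" using tile_facts(3)[OF S(1)] by auto
    have w: "word v" using Nil by simp
    obtain t where t: "0 < t" "t < 1" "0 = (1 - t) *\<^sub>R p + t *\<^sub>R q" and "p \<noteq> q"
      using pq(3) by (auto simp: in_segment)
    have "(1 - t) * \<eta> p + t * \<eta> q = 0" using arg_cong[OF t(3), of \<eta>] by simp
    moreover have "0 \<le> (1 - t) * \<eta> p" "0 \<le> t * \<eta> q" using t height_Z(1)[OF Z(1) w] height_Z(1)[OF Z(2) w] by auto
    ultimately have "(1 - t) * \<eta> p = 0" "t * \<eta> q = 0" by linarith+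
    then have "p = 0" "q = 0" using t height_Z(3)[OF Z(1) w] height_Z(3)[OF Z(2) w] by auto
    then show False using \<open>p \<noteq> q\<close> by simp
  qed (use S in auto)
  then show ?case using S by auto
next
  case (snoc i u)
  then obtain S0 where "S0 \<in> T" "pos u extreme_point_of S0" by force
  then obtain S where "S \<in> T" "edge u i face_of S"
    using boundary_edge[of u i v S0] snoc.prems by auto
  then show ?case using segment_face_extreme(2) by (force simp: add.commute)
qed

lemma sweep_start:
  assumes "word w" "sorted w"
  shows "sweep_path w"
proof -
  have "R \<subseteq> right_of w" if "R \<in> T" for R
    using sorted_bound(1)[OF assms(1) _ assms(2)] tile_facts(3)[OF that] by (auto simp: right_of_def)
  moreover have "\<exists>S\<in>T. edge u i face_of S" if "w = u @ i # v" for u i v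
    using boundary_vertex[of u "i # v"] boundary_edge[of u i v] assms that by auto
  ultimately show ?thesis using assms unfolding sweep_path_def by blast
qed

text \<open>Such a vertex lies on the path, since the decreasing word is the right boundary. It is
  then extreme in the tile of its path edge, hence an end of that edge.\<close>

lemma sweep_end:
  assumes w: "sweep_path w" "sorted_wrt (\<ge>) w" and p: "p \<in> diagram_vertices T" "p \<in> right_of w"
  shows "p \<in> path_vertices w"
proof -
  have word: "word w" using w by (simp add: sweep_path_def)
  obtain R where R: "R \<in> T" "p extreme_point_of R" using p by (auto simp: diagram_vertices_def)
  then have pZ: "p \<in> Z" using tile_facts(3)[OF R(1)] by (auto simp: extreme_point_of_def)
  have "\<kappa> p = path w (\<eta> p)"
    using sorted_bound(2)[OF word pZ w(2)] p(2) by (simp add: right_of_def)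
  then obtain u i v s where uv: "w = u @ i # v" "0 \<le> s" "s \<le> 1" "p = pos u + s *\<^sub>R \<xi> i"
    using path_point[OF word_set[OF word] word_nonempty[OF word]] height_Z[OF pZ word] by metis
  then have pe: "p \<in> edge u i" by (auto simp: closed_segment_def algebra_simps)
  obtain S where S: "S \<in> T" "edge u i face_of S" using w uv unfolding sweep_path_def by blast
  then have "p extreme_point_of S"
    using extreme_transfer[OF R(1) S(1) R(2)] face_of_imp_subset pe by blast
  then have "p extreme_point_of edge u i" using extreme_point_of_face[OF S(2)] pe by blast
  then have "p = pos u \<or> p = pos (u @ [i])" by (simp add: extreme_point_of_segment)
  moreover have "w = u @ (i # v)" "w = (u @ [i]) @ v" using uv by auto
  ultimately show ?thesis unfolding path_vertices_def by blast
qed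

text \<open>\<open>W\<close> collects the words of the sweep; a vertex is found on a path no later
  than the flip that would put it to the left.\<close>

lemma sweep:
  assumes "sweep_path w"
  shows "\<exists>W. (\<forall>w1\<in>W. flip\<^sup>*\<^sup>* w w1) \<and> (\<forall>w1\<in>W. \<forall>w2\<in>W. flip\<^sup>*\<^sup>* w1 w2 \<or> flip\<^sup>*\<^sup>* w2 w1) \<and>
     (\<forall>p\<in>diagram_vertices T \<inter> right_of w. \<exists>w1\<in>W. p \<in> path_vertices w1)"
  using assms
proof (induction "weight w" arbitrary: w rule: less_induct)
  case less
  show ?case
  proof (cases "sorted_wrt (\<ge>) w")
    case True
    then show ?thesis using sweep_end[OF less.prems] by (intro exI[of _ "{w}"]) auto
  next
    case False
    then obtain u i j v where w: "w = u @ i # j # v" "i < j" "rhombus \<xi> (pos u) i j \<in> T"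
      using flip_tile_exists[OF less.prems] by blast
    let ?w' = "u @ j # i # v"
    have f: "flip w ?w'" using w by (auto simp: flip_def)
    note sf = sweep_flip[OF less.prems[unfolded w(1)] w(2,3)]
    obtain W where W: "\<forall>w1\<in>W. flip\<^sup>*\<^sup>* ?w' w1" "\<forall>w1\<in>W. \<forall>w2\<in>W. flip\<^sup>*\<^sup>* w1 w2 \<or> flip\<^sup>*\<^sup>* w2 w1"
      "\<forall>p\<in>diagram_vertices T \<inter> right_of ?w'. \<exists>w1\<in>W. p \<in> path_vertices w1"
      using less.hyps[OF weight_flip[OF f] sf(1)] by blast
    have "\<forall>w1\<in>W. flip\<^sup>*\<^sup>* w w1" using W(1) f by (meson converse_rtranclp_into_rtranclp)
    moreover have "\<exists>w1\<in>insert w W. p \<in> path_vertices w1" if "p \<in> diagram_vertices T \<inter> right_of w" for p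
      using sf(2)[of p] W(3) that w(1) by blast
    ultimately show ?thesis using W(2) by (intro exI[of _ "insert w W"]) auto
  qed
qed

end

context fan
begin

text \<open>Permanence of inversions in counting form: if \<open>i\<close> occurs more than
  \<open>q\<close> times, its occurrence number \<open>q + 1\<close> has more than \<open>p\<close>
  letters \<open>j\<close> before it. No flip moves a smaller letter in front of a larger one that
  it followed.\<close>

lemma flip_order:
  assumes "flip\<^sup>*\<^sup>* w w'" "i < j"
    and "\<forall>u v. w = u @ v \<longrightarrow> count_list u j \<le> p \<longrightarrow> count_list u i \<le> q"
  shows "\<forall>u v. w' = u @ v \<longrightarrow> count_list u j \<le> p \<longrightarrow> count_list u i \<le> q"
  using assms(1)
proof (induction rule: rtranclp_induct)
  case (step x y)
  then obtain u0 c d v0 where x: "x = u0 @ c # d # v0" and y: "y = u0 @ d # c # v0" and cd: "c < d"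
    by (auto simp: flip_def)
  note IH = step.IH[rule_format]
  show ?case
  proof (intro allI impI)
    fix u v assume eq: "y = u @ v" and le: "count_list u j \<le> p"
    show "count_list u i \<le> q"
      using prefix_two_cases[OF eq[unfolded y, symmetric]]
    proof (elim disjE exE conjE)
      fix z assume "u0 = u @ z"
      then have "x = u @ (z @ c # d # v0)" by (simp add: x)
      then show ?thesis using IH le by blast
    next
      assume u: "u = u0 @ [d]"
      show ?thesis
      proof (cases "d = i")
        case True
        \<comment> \<open>If \<open>i\<close> is moved forward, it passes a smaller letter
          \<open>c\<close>, which is neither \<open>i\<close> nor \<open>j\<close>; both counts are
          therefore those of a prefix of \<open>x\<close>.\<close>
        have "count_list (u0 @ [c, d]) i \<le> q"
          using IH[of "u0 @ [c, d]" v0] le u x True cd assms(2) by simp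
        then show ?thesis using u True by (simp split: if_splits)
      next
        case False
        have "count_list u0 i \<le> q"
          using IH[of u0 "c # d # v0"] le u x by (simp split: if_splits)
        then show ?thesis using u False by simp
      qed
    next
      fix z assume z: "u = u0 @ d # c # z" "v0 = z @ v"
      then show ?thesis using IH[of "u0 @ c # d # z" v] le x count_list_swap[of u0 c d z] by simp
    qed
  qed
qed (use assms in blast)

text \<open>Take the counts of \<open>j\<close> in \<open>u'\<close> and of \<open>i\<close> in
  \<open>u\<close> as the bounds in \<open>flip_order\<close>. A prefix of \<open>u @ v\<close> with
  so few letters \<open>j\<close> must be a prefix of \<open>u\<close>, so the invariant holds at
  the start.\<close>

lemma prefix_order:
  assumes f: "flip\<^sup>*\<^sup>* (u @ v) (u' @ v')" and ij: "i < j" and gt: "count_list u' j < count_list u j"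
  shows "count_list u' i \<le> count_list u i"
proof -
  have "count_list x i \<le> count_list u i" if "u @ v = x @ y" "count_list x j \<le> count_list u' j" for x y
  proof -
    have "\<exists>z. u = x @ z \<or> x = u @ z" using that(1) by (auto simp: append_eq_append_conv2)
    then show ?thesis using that(2) gt by auto
  qed
  then show ?thesis using flip_order[OF f ij, of "count_list u' j" "count_list u i"] by blast
qed

subsection \<open>Diagrams through separated vectors\<close>

text \<open>
  \<open>precedes x y\<close> forces \<open>x\<close> to be a prefix of a word earlier in the chain than any word having \<open>y\<close> as a
  prefix; \<open>compatible w x\<close> says that \<open>w\<close> has no inversion that would have to be undone before \<open>x\<close>
  could become a prefix.
\<close>

definition precedes :: "(nat \<Rightarrow> int) \<Rightarrow> (nat \<Rightarrow> int) \<Rightarrow> bool" where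
  "precedes x y \<longleftrightarrow> (\<exists>i\<in>{1..n}. \<exists>j\<in>{1..n}. i < j \<and> y i < x i \<and> x j < y j)"

definition compatible :: "nat list \<Rightarrow> (nat \<Rightarrow> int) \<Rightarrow> bool" where
  "compatible w x \<longleftrightarrow> (\<forall>u i v. w = u @ i # v \<longrightarrow> int (count_list u i) < x i \<longrightarrow>
     (\<forall>j\<in>{1..n}. i < j \<longrightarrow> int (count_list u j) \<le> x j))"

definition prefix_vec :: "nat list \<Rightarrow> (nat \<Rightarrow> int) \<Rightarrow> bool" where
  "prefix_vec w x \<longleftrightarrow> (\<exists>u v. w = u @ v \<and> (\<forall>i\<in>{1..n}. int (count_list u i) = x i))"

lemma prefix_vec_vertex:
  assumes "set w \<subseteq> {1..n}" "prefix_vec w x"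
  shows "plane_proj n \<xi> x \<in> path_vertices w"
proof -
  obtain u v where w: "w = u @ v" and x: "\<forall>i\<in>{1..n}. int (count_list u i) = x i"
    using assms(2) unfolding prefix_vec_def by blast
  have "real (count_list u i) = real_of_int (x i)" if "i \<in> {1..n}" for i
    using x that by (metis of_int_of_nat_eq)
  then have "pos u = plane_proj n \<xi> x"
    using assms(1) w by (subst pos_count) (auto simp: plane_proj_def intro!: sum.cong)
  then show ?thesis unfolding path_vertices_def using w by (intro CollectI exI[of _ u] exI[of _ v]) simp
qed

text \<open>Mark the first \<open>x i\<close> occurrences of each colour \<open>i\<close>. If no
  unmarked letter is directly followed by a marked one, the marked letters form a prefix, whose
  counts are \<open>x\<close>.\<close>

lemma inverted_pair_exists:
  assumes word: "word w" and box: "\<And>i. i \<in> {1..n} \<Longrightarrow> 0 \<le> x i \<and> x i \<le> a i"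
    and np: "\<not> prefix_vec w x"
  shows "\<exists>u c m v. w = u @ c # m # v \<and> x c \<le> int (count_list u c) \<and>
    int (count_list (u @ [c]) m) < x m"
proof (rule ccontr)
  assume none: "\<not> ?thesis"
  define N where "N = length w"
  define marked where "marked k \<longleftrightarrow> int (count_list (take k w) (w ! k)) < x (w ! k)" for k
  have down: "marked k" if k: "Suc k < N" "marked (Suc k)" for k
  proof (rule ccontr)
    assume "\<not> marked k"
    moreover have "w = take k w @ w ! k # w ! Suc k # drop (Suc (Suc k)) w"
      using k(1) by (metis Cons_nth_drop_Suc N_def Suc_lessD append_take_drop_id)
    moreover have "take (Suc k) w = take k w @ [w ! k]"
      using k(1) by (simp add: take_Suc_conv_app_nth N_def)
    ultimately have "w = take k w @ w ! k # w ! Suc k # drop (Suc (Suc k)) w \<and>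
        x (w ! k) \<le> int (count_list (take k w) (w ! k)) \<and>
        int (count_list (take k w @ [w ! k]) (w ! Suc k)) < x (w ! Suc k)"
      using k(2) by (simp only: marked_def not_less)
    then show False using none by (elim notE) (intro exI)
  qed
  define k0 where "k0 = (LEAST k. N \<le> k \<or> \<not> marked k)"
  have k0: "N \<le> k0 \<or> \<not> marked k0" unfolding k0_def by (rule LeastI[of _ N]) simp
  have k0N: "k0 \<le> N" unfolding k0_def by (rule Least_le) simp
  have before: "marked k" if "k < k0" for k
    using not_less_Least[of k] that unfolding k0_def by blast
  have after: "\<not> marked k" if "k0 \<le> k" "k < N" for k
    using that
  proof (induction k rule: dec_induct)
    case base
    then show ?case using k0 by simp
  next
    case (step k)
    then show ?case using down by (meson Suc_lessD)
  qed
  have take_Suc: "take (Suc k) w = take k w @ [w ! k]" if "k < N" for k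
    using that by (simp add: take_Suc_conv_app_nth N_def)
  have le: "int (count_list (take k w) i) \<le> x i" if "k \<le> k0" "i \<in> {1..n}" for k i
    using that(1)
  proof (induction k)
    case 0
    then show ?case using box[OF that(2)] by simp
  next
    case (Suc k)
    then show ?case using take_Suc[of k] before[of k] k0N by (auto simp: marked_def)
  qed
  have ge: "x i \<le> int (count_list (take k0 w) i)" if i: "i \<in> {1..n}" for i
  proof (rule ccontr)
    assume lt: "\<not> ?thesis"
    have "count_list (take k w) i = count_list (take k0 w) i" if "k0 \<le> k" "k \<le> N" for k
      using that
    proof (induction k rule: dec_induct)
      case (step k)
      then have "w ! k \<noteq> i" using after[of k] lt by (auto simp: marked_def)
      then show ?case using step take_Suc[of k] by simp
    qed simp
    from this[of N] have "count_list w i = count_list (take k0 w) i" using k0N by (simp add: N_def)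
    moreover have "int (count_list w i) = a i" using word i unfolding word_def by blast
    ultimately show False using lt box[OF i] by linarith
  qed
  have "\<forall>i\<in>{1..n}. int (count_list (take k0 w) i) = x i" using le[of k0] ge by (meson order_antisym order_refl)
  then show False using np append_take_drop_id[of k0 w] unfolding prefix_vec_def by metis
qed

text \<open>Otherwise a surplus letter \<open>c\<close> would stand before a smaller letter
  \<open>m\<close> still needed, which compatibility forbids. So moving \<open>m\<close> forward is
  a flip.\<close>

lemma inverted_pair_ascent:
  assumes "compatible (u @ c # m # v) x" and set: "set (u @ c # m # v) \<subseteq> {1..n}"
    and um: "x c \<le> int (count_list u c)" "int (count_list (u @ [c]) m) < x m"
  shows "c < m"
proof (rule ccontr)
  assume "\<not> c < m"
  moreover have "c \<noteq> m" using um by auto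
  ultimately have "m < c" by simp
  moreover have "u @ c # m # v = (u @ [c]) @ m # v" "c \<in> {1..n}" using set by auto
  ultimately have "int (count_list (u @ [c]) c) \<le> x c"
    using assms(1) um(2) unfolding compatible_def by blast
  then show False using um(1) by simp
qed

text \<open>The only new inversion is \<open>m\<close> before \<open>c\<close>. It can harm
  \<open>y\<close> only if \<open>y\<close> needs this \<open>c\<close> but not this
  \<open>m\<close>; then \<open>y\<close> precedes \<open>x\<close> through the colours
  \<open>c\<close> and \<open>m\<close>.\<close>

lemma compatible_flip:
  assumes y: "compatible (u @ c # m # v) y" and set: "set (u @ c # m # v) \<subseteq> {1..n}" and cm: "c < m"
    and um: "x c \<le> int (count_list u c)" "int (count_list (u @ [c]) m) < x m"
    and np: "\<not> precedes y x"
  shows "compatible (u @ m # c # v) y"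
  unfolding compatible_def
proof (intro allI impI ballI)
  fix u' i v' j
  assume eq: "u @ m # c # v = u' @ i # v'" and lt: "int (count_list u' i) < y i"
    and j: "j \<in> {1..n}" "i < j"
  have Y: "int (count_list u1 j1) \<le> y j1"
    if "u @ c # m # v = u1 @ i1 # v1" "int (count_list u1 i1) < y i1" "j1 \<in> {1..n}" "i1 < j1" for u1 i1 v1 j1
    by (rule y[unfolded compatible_def, rule_format, OF that])
  show "int (count_list u' j) \<le> y j"
    using append_eq_two_cases[OF eq[symmetric]]
  proof (elim disjE exE conjE)
    fix z assume "u = u' @ i # z"
    then have "u @ c # m # v = u' @ i # (z @ c # m # v)" by simp
    then show ?thesis using lt j by (rule Y)
  next
    assume "u' = u" "i = m"
    then show ?thesis using Y[of "u @ [c]" m v j] lt j cm by simp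
  next
    assume u': "u' = u @ [m]" "i = c"
    have Yj: "int (count_list u j) \<le> y j" using Y[of u c "m # v" j] lt j u' cm by (simp split: if_splits)
    show ?thesis
    proof (cases "j = m \<and> y m \<le> int (count_list u m)")
      case True
      have "y m < x m" using True um(2) cm by simp
      moreover have "x c < y c" using um(1) lt u' cm by (simp split: if_splits)
      moreover have "c \<in> {1..n}" "m \<in> {1..n}" using set by auto
      ultimately have "precedes y x" using cm unfolding precedes_def by blast
      then show ?thesis using np by blast
    next
      case False
      then show ?thesis using Yj u' by auto
    qed
  next
    fix z assume z: "u' = u @ m # c # z" "v = z @ i # v'"
    then have "u @ c # m # v = (u @ c # m # z) @ i # v'" by simp
    from Y[OF this, of j] show ?thesis using z lt j count_list_swap[of u c m z] by simp
  qed
qed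

text \<open>
  A diagram of the part of the zonogon to the right of a path.  The sixth and seventh conditions
  make the path fit the tiles edge to edge; the last one says that an edge of the path without a
  tile on its right lies on the right boundary.
\<close>

definition partial_tiling :: "nat list \<Rightarrow> (real \<times> real) set set \<Rightarrow> bool" where
  "partial_tiling w T \<longleftrightarrow>
     finite T \<and>
     (\<forall>S\<in>T. \<exists>b i j. 1 \<le> i \<and> i < j \<and> j \<le> n \<and> S = rhombus \<xi> b i j) \<and>
     (\<forall>S\<in>T. S \<subseteq> Z \<and> S \<subseteq> right_of w) \<and>
     (\<forall>R\<in>T. \<forall>S\<in>T. R \<inter> S face_of R \<and> R \<inter> S face_of S) \<and>
     (\<forall>p\<in>Z. path w (\<eta> p) < \<kappa> p \<longrightarrow> p \<in> \<Union>T) \<and>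
     (\<forall>S\<in>T. \<forall>u v. w = u @ v \<longrightarrow> pos u \<in> S \<longrightarrow> pos u extreme_point_of S) \<and>
     (\<forall>S\<in>T. \<forall>u i v. w = u @ i # v \<longrightarrow> open_segment (pos u) (pos u + \<xi> i) \<inter> S \<noteq> {} \<longrightarrow>
        edge u i face_of S) \<and>
     (\<forall>u i v. w = u @ i # v \<longrightarrow> (\<exists>S\<in>T. edge u i face_of S) \<or>
        (\<exists>w' u' v'. word w' \<and> sorted_wrt (\<ge>) w' \<and> w' = u' @ i # v' \<and> count_list u' = count_list u))"

lemma partial_tiling_empty:
  assumes "word w" "sorted_wrt (\<ge>) w"
  shows "partial_tiling w {}"
proof -
  have "\<not> path w (\<eta> p) < \<kappa> p" if "p \<in> Z" for p
    using sorted_bound(2)[OF assms(1) that assms(2)] by simp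
  then show ?thesis using assms unfolding partial_tiling_def by blast
qed

lemma path_at_vertex: "set (u @ v) \<subseteq> {1..n} \<Longrightarrow> path (u @ v) (\<eta> (pos u)) = \<kappa> (pos u)"
  using path_nonpos[of v 0] by (simp add: path_append path_top)

lemma open_edge_obtain:
  assumes "q \<in> open_segment (pos u) (pos u + \<xi> i)"
  obtains s where "0 < s" "s < 1" "q = pos u + s *\<^sub>R \<xi> i"
  using assms that by (auto simp: in_segment algebra_simps)

text \<open>Old tiles lie right of the flipped path and the new one lies left of it, so they meet
  only on that path. There the sixth and seventh conditions provide a common corner or edge.\<close>

lemma partial_tiling_flip:
  assumes word: "word (u @ i # j # v)" and ij: "i < j" and T: "partial_tiling (u @ j # i # v) T"
  shows "partial_tiling (u @ i # j # v) (insert (rhombus \<xi> (pos u) i j) T)"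
proof -
  let ?w = "u @ i # j # v" and ?w' = "u @ j # i # v" and ?R = "rhombus \<xi> (pos u) i j"
  note set = word_set[OF word]
  have set': "set ?w' \<subseteq> {1..n}" using set by auto
  have i: "i \<in> {1..n}" and j: "j \<in> {1..n}" using set by auto
  have hi: "0 < \<eta> (\<xi> i)" and hj: "0 < \<eta> (\<xi> j)" using height_pos i j by auto
  have ne: "i \<noteq> j" using ij by simp
  note ext = rhombus_extreme[OF i j ne, of "pos u"]
  have faces: "edge u i face_of ?R" "edge (u @ [i]) j face_of ?R" "edge u j face_of ?R" "edge (u @ [j]) i face_of ?R"
    using rhombus_edge_faces[OF i j ne, of "pos u"] rhombus_edge_faces[OF j i ne[symmetric], of "pos u"]
      rhombus_commute[of \<xi> "pos u" i j] by simp_all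
  note P = T[unfolded partial_tiling_def]
  note fin = P[THEN conjunct1]
  note rh = P[THEN conjunct2, THEN conjunct1, rule_format]
  note SZr = P[THEN conjunct2, THEN conjunct2, THEN conjunct1, rule_format]
  note SZ = SZr[THEN conjunct1] and Sr = SZr[THEN conjunct2]
  note fc = P[THEN conjunct2, THEN conjunct2, THEN conjunct2, THEN conjunct1, rule_format]
  note cov = P[THEN conjunct2, THEN conjunct2, THEN conjunct2, THEN conjunct2, THEN conjunct1, rule_format]
  note vert = P[THEN conjunct2, THEN conjunct2, THEN conjunct2, THEN conjunct2, THEN conjunct2, THEN conjunct1, rule_format]
  note edg = P[THEN conjunct2, THEN conjunct2, THEN conjunct2, THEN conjunct2, THEN conjunct2, THEN conjunct2, THEN conjunct1, rule_format]
  note ecov = P[THEN conjunct2, THEN conjunct2, THEN conjunct2, THEN conjunct2, THEN conjunct2, THEN conjunct2, THEN conjunct2, rule_format]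
  have top: "pos (u @ j # i # z) = pos (u @ i # j # z)" for z by (simp add: algebra_simps)
  have Rh: "\<eta> (pos u) \<le> \<eta> p" "\<eta> p \<le> \<eta> (pos u) + \<eta> (\<xi> i) + \<eta> (\<xi> j)" if "p \<in> ?R" for p
    using that flip_tile_iff[OF ij set] by auto
  have below: "\<eta> (pos x) < \<eta> (pos (x @ k # z))" if "set (x @ k # z) \<subseteq> {1..n}" for x k z
    using that height_pos[of k] height_pos_nonneg[of z] by simp
  have new: "?R \<inter> S face_of ?R \<and> ?R \<inter> S face_of S" if S: "S \<in> T" for S
  proof -
    have "convex S" using rh[OF S] convex_rhombus by auto
    moreover have "\<exists>F. F face_of ?R \<and> F face_of S \<and> p \<in> F" if p: "p \<in> ?R" "p \<in> S" for p
    proof -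
      have single: ?thesis if "?w' = x @ y" "p = pos x" "pos x extreme_point_of ?R" for x y
        using vert[OF S that(1)] that p by (metis face_of_singleton singletonI)
      have k: "\<kappa> p = path ?w' (\<eta> p)"
        using p Sr[OF S] flip_tile_iff[OF ij set, of p] by (auto simp: right_of_def)
      have pZ: "p \<in> Z" using SZ S p by blast
      consider "\<eta> p = \<eta> (pos u)" | "\<eta> p = \<eta> (pos (u @ [j, i]))"
        | "\<eta> (pos u) < \<eta> p" "\<eta> p < \<eta> (pos u) + \<eta> (\<xi> i) + \<eta> (\<xi> j)"
        using Rh[OF p(1)] by fastforce
      then show ?thesis
      proof cases
        case 1
        then have "p = pos u" using k path_at_vertex[OF set'] by (intro coords_eqI) auto
        then show ?thesis using single ext(1) by blast
      next
        case 2
        have "?w' = (u @ [j, i]) @ v" by simp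
        moreover from this have "p = pos (u @ [j, i])"
          using 2 k path_at_vertex[of "u @ [j, i]" v] set' by (intro coords_eqI) auto
        moreover have "pos (u @ [j, i]) = pos u + \<xi> i + \<xi> j" by simp
        ultimately show ?thesis using single ext(4) by metis
      next
        case 3
        have word': "word ?w'" using word word_swap by blast
        obtain x c y s where *: "?w' = x @ c # y" "0 \<le> s" "s \<le> 1" "p = pos x + s *\<^sub>R \<xi> c"
          using path_point[OF set' _ height_Z(1,2)[OF pZ word'] k] by blast
        then have c: "c \<in> {1..n}" using set' by auto
        have sc: "0 \<le> s * \<eta> (\<xi> c)" "s * \<eta> (\<xi> c) \<le> \<eta> (\<xi> c)"
          using * height_pos[OF c] by (auto simp: mult_le_cancel_right1)
        have cs: ?thesis if "x = x' \<and> c = c'" "edge x' c' face_of ?R" "?w' = (x' @ [c']) @ y'" for x' c' y'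
        proof -
          consider "s = 0" | "s = 1" | "0 < s" "s < 1" using * by linarith
          then show ?thesis
          proof cases
            case 1
            then show ?thesis using single[OF *(1)] * that segment_face_extreme(1) by auto
          next
            case 2
            then have "p = pos (x' @ [c'])" using * that by simp
            moreover have "pos (x' @ [c']) extreme_point_of ?R"
              using segment_face_extreme(2)[OF that(2)] by simp
            ultimately show ?thesis using single[OF that(3)] by blast
          next
            case 3
            have "p = (1 - s) *\<^sub>R pos x + s *\<^sub>R (pos x + \<xi> c)" using * by (simp add: algebra_simps)
            then have op: "p \<in> open_segment (pos x) (pos x + \<xi> c)"
              unfolding in_segment using gen_nonzero[OF c] 3 by auto
            then have "edge x c face_of S" using edg[OF S *(1)] p by blast
            then show ?thesis using op that open_closed_segment by blast
          qed
        qed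
        show ?thesis
          using append_eq_two_cases[OF *(1)[symmetric]]
        proof (elim disjE exE conjE)
          fix z assume z: "u = x @ c # z"
          then have "0 \<le> \<eta> (pos z)" using set by (intro height_pos_nonneg) auto
          then have "\<eta> p \<le> \<eta> (pos u)" using z * sc by simp
          then show ?thesis using 3 by simp
        next
          assume "x = u" "c = j"
          then show ?thesis using cs[of u j "i # v"] faces by simp
        next
          assume "x = u @ [j]" "c = i"
          then show ?thesis using cs[of "u @ [j]" i v] faces by simp
        next
          fix z assume z: "x = u @ j # i # z" "v = z @ c # y"
          then have "0 \<le> \<eta> (pos z)" using set by (intro height_pos_nonneg) auto
          then have "\<eta> (pos u) + \<eta> (\<xi> i) + \<eta> (\<xi> j) \<le> \<eta> p" using z * sc by simp
          then show ?thesis using 3 by simp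
        qed
      qed
    qed
    ultimately show ?thesis using Int_face_of_both[OF convex_rhombus] by metis
  qed
  show ?thesis
    unfolding partial_tiling_def
  proof (intro conjI ballI allI impI)
    show "finite (insert ?R T)" using fin by simp
  next
    fix S assume "S \<in> insert ?R T"
    then have "S = ?R \<or> S \<in> T" by simp
    then show "\<exists>b i j. 1 \<le> i \<and> i < j \<and> j \<le> n \<and> S = rhombus \<xi> b i j"
    proof
      assume "S = ?R"
      moreover have "1 \<le> i" "j \<le> n" using i j by auto
      ultimately show ?thesis using ij by blast
    qed (rule rh)
  next
    fix S assume "S \<in> insert ?R T"
    then show "S \<subseteq> Z" using SZ tile_in_Z[OF word] by auto
  next
    fix S assume "S \<in> insert ?R T"
    moreover have "right_of ?w' \<subseteq> right_of ?w"
      using flip_le[OF ij set] by (auto simp: right_of_def intro: order_trans)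
    moreover have "?R \<subseteq> right_of ?w" using flip_tile_iff[OF ij set] by (auto simp: right_of_def)
    ultimately show "S \<subseteq> right_of ?w" using Sr by blast
  next
    fix R S assume "R \<in> insert ?R T" "S \<in> insert ?R T"
    then show "R \<inter> S face_of R" "R \<inter> S face_of S"
      using new fc face_of_refl[OF convex_rhombus[of "pos u" i j]] by (auto simp: Int_commute)
  next
    fix p assume p: "p \<in> Z" "path ?w (\<eta> p) < \<kappa> p"
    show "p \<in> \<Union>(insert ?R T)"
    proof (cases "path ?w' (\<eta> p) < \<kappa> p")
      case False
      then have "\<not> (\<eta> p \<le> \<eta> (pos u) \<or> \<eta> (pos u) + \<eta> (\<xi> i) + \<eta> (\<xi> j) \<le> \<eta> p)"
        using flip_outside[OF ij set, of "\<eta> p"] p by auto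
      then have "p \<in> ?R" using flip_tile_iff[OF ij set, of p] p False by auto
      then show ?thesis by blast
    qed (use cov p in blast)
  next
    fix S x y assume S: "S \<in> insert ?R T" and eq: "?w = x @ y" and xS: "pos x \<in> S"
    have old: "pos x extreme_point_of S" if "?w' = x' @ y'" "pos x' = pos x" "S \<in> T" for x' y'
      using vert[OF that(3,1)] that xS by simp
    show "pos x extreme_point_of S"
      using prefix_two_cases[OF eq[symmetric]]
    proof (elim disjE exE conjE)
      fix z assume z: "u = x @ z"
      show ?thesis
      proof (cases "S \<in> T")
        case True
        then show ?thesis using old[of x "z @ j # i # v"] z by simp
      next
        case False
        then have "S = ?R" using S by simp
        moreover have "z = []"
        proof (rule ccontr)
          assume "z \<noteq> []"
          then obtain c z' where "z = c # z'" by (cases z) auto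
          then have "\<eta> (pos x) < \<eta> (pos u)" using below[of x c z'] set z by auto
          then show False using Rh(1)[of "pos x"] xS \<open>S = ?R\<close> by simp
        qed
        ultimately show ?thesis using ext(1) z by simp
      qed
    next
      assume x: "x = u @ [i]"
      \<comment> \<open>The left corner of the new tile is strictly left of the flipped path, out of
        reach of the old tiles.\<close>
      have "S \<notin> T"
      proof
        assume "S \<in> T"
        then have "pos x \<in> right_of ?w'" using Sr xS by blast
        moreover have "path ?w (\<eta> (pos x)) = \<kappa> (pos x)"
          using path_at_vertex[of "u @ [i]" "j # v"] set x by simp
        moreover have "path ?w (\<eta> (pos x)) < path ?w' (\<eta> (pos x))"
          using flip_inside[OF ij set, of "\<eta> (pos x)"] x hi hj by simp
        ultimately show False by (simp add: right_of_def)
      qed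
      then show ?thesis using S ext(2) x by (simp add: add.commute)
    next
      fix z assume z: "x = u @ i # j # z" "v = z @ y"
      show ?thesis
      proof (cases "S \<in> T")
        case True
        then show ?thesis using old[of "u @ j # i # z" y] z top by simp
      next
        case False
        then have "S = ?R" using S by simp
        moreover have "z = []"
        proof (rule ccontr)
          assume "z \<noteq> []"
          then obtain c z' where "z = c # z'" by (cases z) auto
          then have "\<eta> (pos (u @ [i, j])) < \<eta> (pos x)" using below[of "u @ [i, j]" c z'] set z by auto
          then show False using Rh(2)[of "pos x"] xS \<open>S = ?R\<close> by simp
        qed
        ultimately show ?thesis using ext(4) z by (simp add: add.assoc)
      qed
    qed
  next
    fix S x k y assume S: "S \<in> insert ?R T" and eq: "?w = x @ k # y"
      and "open_segment (pos x) (pos x + \<xi> k) \<inter> S \<noteq> {}"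
    then obtain q where q: "q \<in> open_segment (pos x) (pos x + \<xi> k)" "q \<in> S" by blast
    obtain s where s: "0 < s" "s < 1" "q = pos x + s *\<^sub>R \<xi> k" using open_edge_obtain[OF q(1)] .
    have k: "k \<in> {1..n}" using eq set by auto
    have sk: "0 < s * \<eta> (\<xi> k)" "s * \<eta> (\<xi> k) < \<eta> (\<xi> k)" using s height_pos[OF k] by auto
    have qw: "\<kappa> q = path ?w (\<eta> q)"
      using path_edge[of x k y s] set s unfolding eq by simp
    have old: "edge x k face_of S" if "?w' = x' @ k # y'" "pos x' = pos x" "S \<in> T" for x' y'
      using edg[OF that(3,1)] that q by auto
    have notT: "S \<notin> T" if "\<eta> (pos u) < \<eta> q" "\<eta> q < \<eta> (pos u) + \<eta> (\<xi> i) + \<eta> (\<xi> j)"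
    proof
      assume "S \<in> T"
      then have "q \<in> right_of ?w'" using Sr q by blast
      then show False using flip_inside[OF ij set that] qw by (simp add: right_of_def)
    qed
    show "edge x k face_of S"
      using append_eq_two_cases[OF eq[symmetric]]
    proof (elim disjE exE conjE)
      fix z assume z: "u = x @ k # z"
      then have "0 \<le> \<eta> (pos z)" using set by (intro height_pos_nonneg) auto
      then have "\<eta> q < \<eta> (pos u)" using z s sk by simp
      then have "S \<in> T" using S Rh(1)[of q] q by auto
      then show ?thesis using old[of x "z @ j # i # v"] z by simp
    next
      assume x: "x = u" "k = i"
      then have "S \<notin> T" using notT s sk hj by simp
      then show ?thesis using S faces x by auto
    next
      assume x: "x = u @ [i]" "k = j"
      then have "S \<notin> T" using notT s sk hi by simp
      then show ?thesis using S faces x by auto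
    next
      fix z assume z: "x = u @ i # j # z" "v = z @ k # y"
      then have "0 \<le> \<eta> (pos z)" using set by (intro height_pos_nonneg) auto
      then have "\<eta> (pos u) + \<eta> (\<xi> i) + \<eta> (\<xi> j) < \<eta> q" using z s sk by simp
      then have "S \<in> T" using S Rh(2)[of q] q by auto
      then show ?thesis using old[of "u @ j # i # z" y] z top by simp
    qed
  next
    fix x k y assume eq: "?w = x @ k # y"
    have old: "(\<exists>S\<in>insert ?R T. edge x k face_of S) \<or>
        (\<exists>w' u' v'. word w' \<and> sorted_wrt (\<ge>) w' \<and> w' = u' @ k # v' \<and> count_list u' = count_list x)"
      if "?w' = x' @ k # y'" "pos x' = pos x" "count_list x' = count_list x" for x' y'
      using ecov[OF that(1)] that(2,3) by auto
    show "(\<exists>S\<in>insert ?R T. edge x k face_of S) \<or>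
        (\<exists>w' u' v'. word w' \<and> sorted_wrt (\<ge>) w' \<and> w' = u' @ k # v' \<and> count_list u' = count_list x)"
      using append_eq_two_cases[OF eq[symmetric]]
    proof (elim disjE exE conjE)
      fix z assume "u = x @ k # z"
      then show ?thesis using old[of x "z @ j # i # v"] by simp
    next
      fix z assume z: "x = u @ i # j # z" "v = z @ k # y"
      show ?thesis
        by (rule old[of "u @ j # i # z" y]) (use z top count_list_swap[of u j i z] in auto)
    qed (use faces in auto)
  qed
qed

text \<open>Going back over the flip loses only the prefix \<open>u @ [j]\<close>, and this is the
  right corner of the added tile. Vectors reached further right thus remain vertices.\<close>

lemma path_vertices_flip:
  assumes "i \<in> {1..n}" "j \<in> {1..n}" "i < j"
  shows "path_vertices (u @ j # i # v) \<subseteq>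
    path_vertices (u @ i # j # v) \<union> diagram_vertices (insert (rhombus \<xi> (pos u) i j) T)"
proof
  fix p assume "p \<in> path_vertices (u @ j # i # v)"
  then obtain x y where eq: "u @ j # i # v = x @ y" and p: "p = pos x"
    unfolding path_vertices_def by blast
  have in_path: "p \<in> path_vertices (u @ i # j # v)" if "u @ i # j # v = x' @ y'" "pos x' = pos x" for x' y'
    unfolding path_vertices_def using that p by (intro CollectI exI[of _ x'] exI[of _ y']) simp
  show "p \<in> path_vertices (u @ i # j # v) \<union> diagram_vertices (insert (rhombus \<xi> (pos u) i j) T)"
    using prefix_two_cases[OF eq[symmetric]]
  proof (elim disjE exE conjE)
    fix z assume "u = x @ z"
    then show ?thesis using in_path[of x "z @ i # j # v"] by simp
  next
    assume "x = u @ [j]"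
    then show ?thesis
      using rhombus_extreme(3)[of i j "pos u"] assms p unfolding diagram_vertices_def by (auto simp: add.commute)
  next
    fix z assume "x = u @ j # i # z" "v = z @ y"
    then show ?thesis using in_path[of "u @ i # j # z" y] by (simp add: algebra_simps)
  qed
qed

text \<open>Vectors that are prefixes of \<open>w\<close> are path vertices already and are dropped
  from \<open>Y\<close>. The flip goes towards a minimal remaining vector, or is any ascent if none
  remains; its tile joins the diagram obtained from the recursion.\<close>

lemma partial_tiling_through:
  assumes "word w" "finite Y"
    and "\<And>x i. x \<in> Y \<Longrightarrow> i \<in> {1..n} \<Longrightarrow> 0 \<le> x i \<and> x i \<le> a i"
    and "\<And>x. x \<in> Y \<Longrightarrow> compatible w x"
    and "transp_on Y precedes" "asymp_on Y precedes"
  shows "\<exists>T. partial_tiling w T \<and> plane_proj n \<xi> ` Y \<subseteq> path_vertices w \<union> diagram_vertices T"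
  using assms
proof (induction "weight w" arbitrary: w Y rule: less_induct)
  case less
  note word = less.prems(1) and box = less.prems(3) and compat = less.prems(4)
  note set = word_set[OF word]
  define Y' where "Y' = {x \<in> Y. \<not> prefix_vec w x}"
  have Y'Y: "Y' \<subseteq> Y" by (auto simp: Y'_def)
  have reached: "plane_proj n \<xi> x \<in> path_vertices w" if "x \<in> Y - Y'" for x
    using prefix_vec_vertex[OF set] that by (auto simp: Y'_def)
  show ?case
  proof (cases "Y' = {} \<and> sorted_wrt (\<ge>) w")
    case True
    then have "partial_tiling w {}" using partial_tiling_empty word by blast
    then show ?thesis using reached True by (intro exI[of _ "{}"]) auto
  next
    case False
    have "\<exists>u i j v. w = u @ i # j # v \<and> i < j \<and> (\<forall>y\<in>Y'. compatible (u @ j # i # v) y)"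
    proof (cases "Y' = {}")
      case True
      then have "\<not> sorted_wrt (\<ge>) w" using False by simp
      then obtain u i j v where "w = u @ i # j # v" "i < j" by (rule ex_ascent)
      then have "w = u @ i # j # v \<and> i < j \<and> (\<forall>y\<in>Y'. compatible (u @ j # i # v) y)"
        using True by simp
      then show ?thesis by (intro exI)
    next
      case False
      obtain x where x: "x \<in> Y'" and min: "\<And>y. y \<in> Y' \<Longrightarrow> \<not> precedes y x"
      proof -
        have asym: "asymp_on Y' precedes" using less.prems(6) Y'Y by (rule asymp_on_subset)
        have "\<exists>m\<in>Y'. \<forall>y\<in>Y'. y \<noteq> m \<longrightarrow> \<not> precedes y m"
          using finite_subset[OF Y'Y less.prems(2)] asym transp_on_subset[OF less.prems(5) Y'Y] False
          by (rule Finite_Set.bex_min_element)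
        then obtain m where m: "m \<in> Y'" "\<And>y. y \<in> Y' \<Longrightarrow> y \<noteq> m \<Longrightarrow> \<not> precedes y m" by blast
        have "\<not> precedes y m" if "y \<in> Y'" for y
          using m(2)[OF that] asymp_onD[OF asym m(1) m(1)] by (cases "y = m") auto
        then show thesis by (rule that[OF m(1)])
      qed
      have xY: "x \<in> Y" and np: "\<not> prefix_vec w x" using x by (auto simp: Y'_def)
      obtain u c m v where um: "w = u @ c # m # v" "x c \<le> int (count_list u c)"
          "int (count_list (u @ [c]) m) < x m"
      proof -
        have "\<exists>u c m v. w = u @ c # m # v \<and> x c \<le> int (count_list u c) \<and>
            int (count_list (u @ [c]) m) < x m"
          by (rule inverted_pair_exists[OF word _ np]) (rule box[OF xY])
        then show thesis using that by (elim exE conjE)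
      qed
      have cm: "c < m" using inverted_pair_ascent[of u c m v x] compat[OF xY] set um by simp
      have "compatible (u @ m # c # v) y" if y: "y \<in> Y'" for y
      proof (rule compatible_flip[OF _ _ cm um(2,3) min[OF y]])
        have "y \<in> Y" using y Y'Y by blast
        then show "compatible (u @ c # m # v) y" using compat um(1) by simp
      qed (use set um(1) in simp)
      then have "w = u @ c # m # v \<and> c < m \<and> (\<forall>y\<in>Y'. compatible (u @ m # c # v) y)"
        using um(1) cm by simp
      then show ?thesis by (intro exI)
    qed
    then obtain u i j v where w: "w = u @ i # j # v" and ij: "i < j"
      and Y': "\<forall>y\<in>Y'. compatible (u @ j # i # v) y" by (elim exE conjE)
    have f: "flip w (u @ j # i # v)" using w ij by (auto simp: flip_def)
    have "\<exists>T. partial_tiling (u @ j # i # v) T \<and>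
        plane_proj n \<xi> ` Y' \<subseteq> path_vertices (u @ j # i # v) \<union> diagram_vertices T"
    proof (rule less.hyps[OF weight_flip[OF f]])
      show "word (u @ j # i # v)" using word_flip[OF f] word by simp
      show "finite Y'" using finite_subset[OF Y'Y less.prems(2)] .
      show "transp_on Y' precedes" using less.prems(5) Y'Y by (rule transp_on_subset)
      show "asymp_on Y' precedes" using less.prems(6) Y'Y by (rule asymp_on_subset)
      show "0 \<le> x i \<and> x i \<le> a i" if "x \<in> Y'" "i \<in> {1..n}" for x i
        using box[of x i] that Y'Y by blast
      show "compatible (u @ j # i # v) x" if "x \<in> Y'" for x
        using Y' that by (rule bspec)
    qed
    then obtain T where T: "partial_tiling (u @ j # i # v) T"
      "plane_proj n \<xi> ` Y' \<subseteq> path_vertices (u @ j # i # v) \<union> diagram_vertices T" by blast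
    define T' where "T' = insert (rhombus \<xi> (pos u) i j) T"
    have "partial_tiling w T'" unfolding T'_def w
      using partial_tiling_flip[OF _ ij T(1)] word w by simp
    moreover have "path_vertices (u @ j # i # v) \<subseteq> path_vertices w \<union> diagram_vertices T'"
      unfolding T'_def w using set w ij by (intro path_vertices_flip) auto
    moreover have "diagram_vertices T \<subseteq> diagram_vertices T'"
      by (auto simp: diagram_vertices_def T'_def)
    moreover have "plane_proj n \<xi> x \<in> path_vertices w \<union> diagram_vertices T'" if "x \<in> Y" for x
      using reached[of x] T(2) calculation(2,3) that by (cases "x \<in> Y'") auto
    ultimately show ?thesis by (intro exI[of _ T'] conjI image_subsetI)
  qed
qed

lemma partial_tiling_sorted:
  assumes word: "word w" and sorted: "sorted w" and T: "partial_tiling w T"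
  shows "RT_diagram n \<xi> a T" "path_vertices w \<subseteq> diagram_vertices T"
proof -
  note P = T[unfolded partial_tiling_def]
  note fin = P[THEN conjunct1]
  note rh = P[THEN conjunct2, THEN conjunct1]
  note SZ = P[THEN conjunct2, THEN conjunct2, THEN conjunct1]
  note fc = P[THEN conjunct2, THEN conjunct2, THEN conjunct2, THEN conjunct1]
  note cov = P[THEN conjunct2, THEN conjunct2, THEN conjunct2, THEN conjunct2, THEN conjunct1, rule_format]
  note ecov = P[THEN conjunct2, THEN conjunct2, THEN conjunct2, THEN conjunct2, THEN conjunct2,
      THEN conjunct2, THEN conjunct2, rule_format]
  have edges: "\<exists>S\<in>T. edge u i face_of S" if w: "w = u @ i # v" for u i v
    using ecov[OF w]
  proof (elim disjE exE conjE)
    fix w' u' v'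
    assume w': "word w'" "sorted_wrt (\<ge>) w'" "w' = u' @ i # v'" "count_list u' = count_list u"
    have i: "i \<in> {1..n}" using word_set[OF word] w by auto
    \<comment> \<open>No edge lies on both boundaries. For \<open>i \<noteq> 1\<close> the
      increasing prefix contains all letters 1 and the decreasing one none; for \<open>i = 1\<close>
      the decreasing prefix contains all letters \<open>n\<close> and the increasing one
      none.\<close>
    have False
    proof (cases "i = 1")
      case False
      then have "1 \<notin> set (i # v)" using sorted w i by (auto simp: sorted_append)
      then have "int (count_list u 1) = a 1" using word w two_le by (intro word_count_full) auto
      moreover have "count_list u' 1 = 0"
        using w'(2,3) False i by (auto simp: sorted_wrt_append count_list_0_iff)
      ultimately show False using w'(4) a_pos[of 1] two_le by simp
    next
      case True
      then have "n \<notin> set (i # v')" using w'(2,3) two_le by (auto simp: sorted_wrt_append)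
      then have "int (count_list u' n) = a n" using w'(1,3) two_le by (intro word_count_full) auto
      moreover have "count_list u n = 0"
        using sorted w True two_le by (auto simp: sorted_append count_list_0_iff)
      ultimately show False using w'(4) a_pos[of n] two_le by simp
    qed
    then show ?thesis ..
  qed
  have "Z \<subseteq> \<Union>T"
  proof
    fix p assume p: "p \<in> Z"
    have "path w (\<eta> p) \<le> \<kappa> p" using sorted_bound(1)[OF word p sorted] .
    then consider "path w (\<eta> p) < \<kappa> p" | "\<kappa> p = path w (\<eta> p)" by linarith
    then show "p \<in> \<Union>T"
    proof cases
      case 1
      then show ?thesis using cov[OF p] by blast
    next
      case 2
      then obtain u i v s where s: "w = u @ i # v" "0 \<le> s" "s \<le> 1" "p = pos u + s *\<^sub>R \<xi> i"
        using path_point[OF word_set[OF word] word_nonempty[OF word]] height_Z[OF p word] by metis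
      then have "p \<in> edge u i" by (auto simp: closed_segment_def algebra_simps)
      then show ?thesis using edges[OF s(1)] face_of_imp_subset by blast
    qed
  qed
  moreover have "\<Union>T \<subseteq> Z" using SZ by blast
  ultimately have "\<Union>T = Z" by blast
  then show "RT_diagram n \<xi> a T" unfolding RT_diagram_def by (intro conjI fin rh fc)
  show "path_vertices w \<subseteq> diagram_vertices T"
  proof
    fix p assume "p \<in> path_vertices w"
    then obtain u v where uv: "w = u @ v" "p = pos u" unfolding path_vertices_def by blast
    show "p \<in> diagram_vertices T"
    proof (cases v)
      case (Cons i v')
      then show ?thesis
        using edges[of u i v'] uv segment_face_extreme(1) by (fastforce simp: diagram_vertices_def)
    next
      case Nil
      then have "u \<noteq> []" using uv word_nonempty[OF word] by simp
      then obtain u' i where u: "u = u' @ [i]" by (metis rev_exhaust)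
      then have p: "p = pos u' + \<xi> i" and "w = u' @ i # []" using uv Nil by simp_all
      then obtain S where S: "S \<in> T" "edge u' i face_of S" using edges by blast
      show ?thesis
        using S(1) segment_face_extreme(2)[OF S(2)] unfolding diagram_vertices_def p by blast
    qed
  qed
qed

lemma sorted_word_exists: "\<exists>w. word w \<and> sorted w"
proof -
  have "\<exists>w. set w \<subseteq> {1..k} \<and> sorted w \<and> (\<forall>i\<in>{1..k}. int (count_list w i) = a i)" if "k \<le> n" for k
    using that
  proof (induction k)
    case (Suc k)
    then obtain w where w: "set w \<subseteq> {1..k}" "sorted w" "\<forall>i\<in>{1..k}. int (count_list w i) = a i" by auto
    let ?w = "w @ replicate (nat (a (Suc k))) (Suc k)"
    have "Suc k \<notin> set w" using w by auto
    then have "count_list w (Suc k) = 0" by (simp add: count_list_0_iff)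
    moreover have cr: "count_list (replicate m x) y = (if x = y then m else 0)" for m and x y :: nat
      by (induction m) auto
    moreover have "0 < a (Suc k)" using a_pos Suc.prems by simp
    ultimately have "int (count_list ?w i) = a i" if "i \<in> {1..Suc k}" for i
      using w(3) that by (cases "i = Suc k") auto
    then have "\<forall>i\<in>{1..Suc k}. int (count_list ?w i) = a i" by blast
    moreover have "set ?w \<subseteq> {1..Suc k}" "sorted ?w"
      using w by (auto simp: sorted_append sorted_replicate)
    ultimately show ?case by blast
  qed simp
  then show ?thesis unfolding word_def by blast
qed

lemma compatible_sorted:
  assumes "sorted w" "\<And>i. i \<in> {1..n} \<Longrightarrow> 0 \<le> x i"
  shows "compatible w x"
  unfolding compatible_def
proof (intro allI impI ballI)
  fix u i v j assume "w = u @ i # v" "j \<in> {1..n}" "i < j"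
  then have "count_list u j = 0" using assms(1) by (auto simp: sorted_append count_list_0_iff)
  then show "int (count_list u j) \<le> x j" using assms(2) \<open>j \<in> {1..n}\<close> by simp
qed

section \<open>Separation makes \<open>precedes\<close> a strict partial order\<close>

definition separated :: "(nat \<Rightarrow> int) set \<Rightarrow> bool" where
  "separated X \<longleftrightarrow> \<not> (\<exists>i j k. 1 \<le> i \<and> i < j \<and> j < k \<and> k \<le> n \<and>
     (\<exists>x\<in>X. \<exists>x'\<in>X. x i < x' i \<and> x j > x' j \<and> x k < x' k))"

text \<open>If an inequality failed, \<open>c\<close> would extend \<open>i\<close>,
  \<open>j\<close> to a forbidden triple, as its smallest or its largest index.\<close>

lemma separated_precedes:
  assumes X: "separated X" and x: "x \<in> X" "y \<in> X"
    and ij: "i \<in> {1..n}" "j \<in> {1..n}" "i < j" "y i < x i" "x j < y j"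
  shows "c \<in> {1..n} \<Longrightarrow> c \<le> i \<Longrightarrow> y c \<le> x c" "c \<in> {1..n} \<Longrightarrow> j \<le> c \<Longrightarrow> x c \<le> y c"
proof -
  have sep: False
    if "1 \<le> i" "i < j" "j < k" "k \<le> n" "p \<in> X" "q \<in> X" "p i < q i" "q j < p j" "p k < q k" for i j k p q
    using X that unfolding separated_def by blast
  show "y c \<le> x c" if "c \<in> {1..n}" "c \<le> i"
    using sep[of c i j x y] that ij x by (cases "c = i") force+
  show "x c \<le> y c" if "c \<in> {1..n}" "j \<le> c"
    using sep[of i j c y x] that ij x by (cases "c = j") force+
qed

lemma separated_transp:
  assumes X: "separated X"
  shows "transp_on X precedes"
proof (rule transp_onI)
  fix x y z assume "x \<in> X" "y \<in> X" "z \<in> X" "precedes x y" "precedes y z"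
  then obtain i j k l where ij: "i \<in> {1..n}" "j \<in> {1..n}" "i < j" "y i < x i" "x j < y j"
    and kl: "k \<in> {1..n}" "l \<in> {1..n}" "k < l" "z k < y k" "y l < z l"
    unfolding precedes_def by blast
  note xy = separated_precedes[OF X \<open>x \<in> X\<close> \<open>y \<in> X\<close> ij]
  note yz = separated_precedes[OF X \<open>y \<in> X\<close> \<open>z \<in> X\<close> kl]
  \<comment> \<open>Both comparisons hold weakly at the smaller of the two lower witnesses, and at
    least one strictly; the larger upper witness works in the same way.\<close>
  have "z (min i k) < x (min i k)"
    using xy(1)[of k] yz(1)[of i] ij kl by (cases "i \<le> k") (auto simp: min_def)
  moreover have "x (max j l) < z (max j l)"
    using xy(2)[of l] yz(2)[of j] ij kl by (cases "j \<le> l") (auto simp: max_def)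
  ultimately show "precedes x z"
    unfolding precedes_def using ij kl
    by (intro bexI[of _ "min i k"] bexI[of _ "max j l"]) auto
qed

lemma separated_asymp:
  assumes X: "separated X"
  shows "asymp_on X precedes"
proof (rule asymp_onI, rule notI)
  fix x y assume "x \<in> X" "y \<in> X" "precedes x y" "precedes y x"
  then obtain i j k l where ij: "i \<in> {1..n}" "j \<in> {1..n}" "i < j" "y i < x i" "x j < y j"
    and kl: "k \<in> {1..n}" "l \<in> {1..n}" "k < l" "x k < y k" "y l < x l"
    unfolding precedes_def by blast
  note xy = separated_precedes[OF X \<open>x \<in> X\<close> \<open>y \<in> X\<close> ij]
  note yx = separated_precedes[OF X \<open>y \<in> X\<close> \<open>x \<in> X\<close> kl]
  show False using xy(1)[of k] yx(1)[of i] ij kl by (cases "i \<le> k") auto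
qed

lemma diagram_exists:
  assumes X: "X \<subseteq> int_box n a" "separated X"
  shows "\<exists>T. RT_diagram n \<xi> a T \<and> plane_proj n \<xi> ` X \<subseteq> diagram_vertices T"
proof -
  obtain w where w: "word w" "sorted w" using sorted_word_exists by blast
  have "finite (int_box n a)" unfolding int_box_def by (intro finite_PiE) auto
  then have fin: "finite X" using X(1) finite_subset by blast
  have box: "0 \<le> x i \<and> x i \<le> a i" if "x \<in> X" "i \<in> {1..n}" for x i
    using X(1) that unfolding int_box_def by (auto simp: PiE_iff)
  have comp: "compatible w x" if "x \<in> X" for x
    using compatible_sorted[OF w(2)] box[OF that] by blast
  obtain T where T: "partial_tiling w T" "plane_proj n \<xi> ` X \<subseteq> path_vertices w \<union> diagram_vertices T"
  proof -
    have "\<exists>T. partial_tiling w T \<and> plane_proj n \<xi> ` X \<subseteq> path_vertices w \<union> diagram_vertices T"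
      by (rule partial_tiling_through[OF w(1) fin _ comp separated_transp[OF X(2)] separated_asymp[OF X(2)]])
        (rule box)
    then show thesis using that by blast
  qed
  then show ?thesis using partial_tiling_sorted[OF w T(1)] by blast
qed

lemma diagram_separated:
  assumes X: "X \<subseteq> int_box n a" and RT: "RT_diagram n \<xi> a T"
    and XT: "plane_proj n \<xi> ` X \<subseteq> diagram_vertices T"
  shows "separated X"
proof -
  interpret tiling n \<xi> \<eta> \<kappa> \<delta> a T by unfold_locales (rule RT)
  obtain w where w: "word w" "sorted w" using sorted_word_exists by blast
  obtain W where W: "\<forall>w1\<in>W. flip\<^sup>*\<^sup>* w w1"
    and chain: "\<forall>w1\<in>W. \<forall>w2\<in>W. flip\<^sup>*\<^sup>* w1 w2 \<or> flip\<^sup>*\<^sup>* w2 w1"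
    and vertices: "\<forall>p\<in>diagram_vertices T \<inter> right_of w. \<exists>w1\<in>W. p \<in> path_vertices w1"
    using sweep[OF sweep_start[OF w]] by (elim exE conjE)
  have words: "word w1" if "w1 \<in> W" for w1
    using bspec[OF W that]
    by (induction rule: rtranclp_induct) (use w(1) word_flip in auto)
  \<comment> \<open>Injectivity of the projection turns the vertex found on a path back into the
    counts of a prefix.\<close>
  have prefix: "\<exists>u v. u @ v \<in> W \<and> (\<forall>i\<in>{1..n}. x i = int (count_list u i))" if x: "x \<in> X" for x
  proof -
    have V: "plane_proj n \<xi> x \<in> diagram_vertices T" using XT x by blast
    then obtain S where "S \<in> T" "plane_proj n \<xi> x \<in> S"
      unfolding diagram_vertices_def extreme_point_of_def by blast
    then have "plane_proj n \<xi> x \<in> Z" using tile_facts(3) by blast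
    then have "plane_proj n \<xi> x \<in> right_of w"
      using sorted_bound(1)[OF w(1) _ w(2)] by (simp add: right_of_def)
    with V obtain w1 where w1: "w1 \<in> W" "plane_proj n \<xi> x \<in> path_vertices w1"
      using vertices by blast
    then obtain u v where uv: "w1 = u @ v" "plane_proj n \<xi> x = pos u"
      unfolding path_vertices_def by blast
    have "set u \<subseteq> {1..n}" using word_set[OF words[OF w1(1)]] uv(1) by simp
    then have "plane_proj n \<xi> x = plane_proj n \<xi> (count_vec u)" using uv pos_eq_proj by simp
    moreover have "x \<in> {1..n} \<rightarrow>\<^sub>E UNIV" using X x by (auto simp: int_box_def PiE_iff)
    moreover have "count_vec u \<in> {1..n} \<rightarrow>\<^sub>E UNIV" by (simp add: count_vec_def)
    ultimately have "x = count_vec u" by (rule inj_onD[OF proj_inj])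
    then show ?thesis using uv(1) w1(1) by (intro exI[of _ u] exI[of _ v]) (simp add: count_vec_def)
  qed
  show ?thesis
    unfolding separated_def
  proof (rule notI, elim exE bexE conjE)
    fix i j k x x'
    assume ijk: "1 \<le> i" "i < j" "j < k" "k \<le> n" and X: "x \<in> X" "x' \<in> X"
      and lt: "x i < x' i" "x' j < x j" "x k < x' k"
    obtain u v where u: "u @ v \<in> W" "\<forall>i\<in>{1..n}. x i = int (count_list u i)" using prefix[OF X(1)] by blast
    obtain u' v' where u': "u' @ v' \<in> W" "\<forall>i\<in>{1..n}. x' i = int (count_list u' i)" using prefix[OF X(2)] by blast
    show False
      using bspec[OF bspec[OF chain u(1)] u'(1)]
    proof
      assume "flip\<^sup>*\<^sup>* (u @ v) (u' @ v')"
      then show False using prefix_order[of u v u' v' i j] u(2) u'(2) ijk lt by simp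
    next
      assume "flip\<^sup>*\<^sup>* (u' @ v') (u @ v)"
      then show False using prefix_order[of u' v' u v j k] u(2) u'(2) ijk lt by simp
    qed
  qed
qed

end

theorem theorem5p2:
  fixes n :: nat and \<xi> :: "nat \<Rightarrow> real \<times> real"
    and a :: "nat \<Rightarrow> int" and X :: "(nat \<Rightarrow> int) set"
  assumes "2 \<le> n"
    and "generating_vectors n \<xi>"
    and "\<forall>i\<in>{1..n}. 0 < a i"
    and "X \<subseteq> int_box n a"
  shows "(\<exists>T. RT_diagram n \<xi> a T \<and> plane_proj n \<xi> ` X \<subseteq> diagram_vertices T) \<longleftrightarrow>
         \<not> (\<exists>i j k. 1 \<le> i \<and> i < j \<and> j < k \<and> k \<le> n \<and>
              (\<exists>x\<in>X. \<exists>x'\<in>X. x i < x' i \<and> x j > x' j \<and> x k < x' k))"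
proof -
  \<comment> \<open>\<open>\<eta> p\<close> is the determinant of \<open>\<xi> n - \<xi> 1\<close>
    and \<open>p\<close>, and \<open>\<kappa> p\<close> their inner product: a rotated and rescaled
    frame. \<open>m\<close> is the squared length of this difference, and dividing by it normalises
    \<open>\<delta>\<close>.\<close>
  define b c where "b = fst (\<xi> n) - fst (\<xi> 1)" and "c = snd (\<xi> n) - snd (\<xi> 1)"
  define \<eta> where "\<eta> p = b * snd p - c * fst p" for p :: "real \<times> real"
  define \<kappa> where "\<kappa> p = b * fst p + c * snd p" for p :: "real \<times> real"
  define m where "m = b\<^sup>2 + c\<^sup>2"
  define \<delta> where "\<delta> = (b / m, c / m)"
  have cw: "fst (\<xi> i) * snd (\<xi> j) - snd (\<xi> i) * fst (\<xi> j) < 0"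
    if "i \<in> {1..n}" "j \<in> {1..n}" "i < j" for i j
    using assms(2) that unfolding generating_vectors_def by blast
  have hp: "0 < \<eta> (\<xi> i)" if i: "i \<in> {1..n}" for i
  proof -
    \<comment> \<open>By the clockwise order both determinants are negative, except that one
      vanishes if \<open>i\<close> is 1 or \<open>n\<close>.\<close>
    have "\<eta> (\<xi> i) = - (fst (\<xi> 1) * snd (\<xi> i) - snd (\<xi> 1) * fst (\<xi> i))
        - (fst (\<xi> i) * snd (\<xi> n) - snd (\<xi> i) * fst (\<xi> n))"
      by (simp add: \<eta>_def b_def c_def algebra_simps)
    then show ?thesis using cw[of 1 i] cw[of i n] cw[of 1 n] i assms(1)
      by (cases "i = 1"; cases "i = n") auto
  qed
  have "b \<noteq> 0 \<or> c \<noteq> 0" using hp[of 1] assms(1) by (auto simp: \<eta>_def)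
  then have m: "0 < m" by (auto simp: m_def sum_power2_gt_zero_iff)
  interpret fan n \<xi> \<eta> \<kappa> \<delta> a
  proof (rule fan.intro)
    show "linear \<eta>" "linear \<kappa>"
      unfolding \<eta>_def \<kappa>_def by (auto intro!: linearI simp: algebra_simps)
    fix p :: "real \<times> real" assume p: "\<eta> p = 0" "\<kappa> p = 0"
    have "m * fst p = b * \<kappa> p - c * \<eta> p" "m * snd p = c * \<kappa> p + b * \<eta> p"
      by (simp_all add: \<eta>_def \<kappa>_def m_def power2_eq_square algebra_simps)
    then show "p = 0" using p m by (simp add: prod_eq_iff)
  next
    show "\<eta> \<delta> = 0" by (simp add: \<eta>_def \<delta>_def)
    have "\<kappa> \<delta> = m / m"
      by (simp add: \<kappa>_def \<delta>_def power2_eq_square flip: add_divide_distrib) (simp add: m_def power2_eq_square)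
    then show "\<kappa> \<delta> = 1" using m by simp
  next
    fix i j assume ij: "i \<in> {1..n}" "j \<in> {1..n}" "i < j"
    have "\<kappa> (\<xi> j) * \<eta> (\<xi> i) - \<kappa> (\<xi> i) * \<eta> (\<xi> j) = m * - (fst (\<xi> i) * snd (\<xi> j) - snd (\<xi> i) * fst (\<xi> j))"
      by (simp add: \<eta>_def \<kappa>_def m_def power2_eq_square algebra_simps)
    also have "\<dots> > 0" using cw[OF ij] m by (intro mult_pos_pos) auto
    finally show "\<kappa> (\<xi> i) / \<eta> (\<xi> i) < \<kappa> (\<xi> j) / \<eta> (\<xi> j)"
      using hp[OF ij(1)] hp[OF ij(2)] by (simp add: divide_simps mult.commute)
  qed (use assms hp in \<open>auto simp: generating_vectors_def\<close>)
  have "(\<exists>T. RT_diagram n \<xi> a T \<and> plane_proj n \<xi> ` X \<subseteq> diagram_vertices T) \<longleftrightarrow> separated X"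
    using diagram_exists[OF assms(4)] diagram_separated[OF assms(4)] by (intro iffI) (elim exE conjE)
  then show ?thesis unfolding separated_def .
qed

end
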